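(* Let $T_4$ be the $4$-regular tree and let $T_4 \Box \mathbb{Z}$ be the Cartesian product graph of $T_4$ and the line $\mathbb{Z}$. Then, for Bernoulli bond percolation on $T_4\Box\mathbb{Z}$, $$p_c(T_4 \Box \mathbb{Z}) < 0.225 < 0.232 < p_u(T_4\Box\mathbb{Z}).$$
   Context: $T_4$ is the infinite tree in which every vertex has degree $4$; $\mathbb{Z}$ denotes the graph on the integers with edges $\{k,k+1\}$. The Cartesian product $G_1\Box G_2$ has vertex set $V(G_1)\times V(G_2)$, with $(u,k)$ and $(v,l)$ adjacent iff ($u=v$ and $\{k,l\}\in E(G_2)$) or ($\{u,v\}\in E(G_1)$ and $k=l$). Bernoulli bond percolation with parameter $p\in[0,1]$ on an infinite, connected, locally finite graph $G=(V,E)$: each edge is independently open with probability $p$ and closed with probability $1-p$. Clusters are the connected components of the subgraph of open edges. The critical probability and the uniqueness threshold are $$p_c(G)=\inf\{p\in[0,1] \mid \text{there exists an infinite cluster almost surely}\},$$ $$p_u(G)=\inf\{p\in[0,1] \mid \text{there exists a unique infinite cluster almost surely}\}.$$ Known result from the literature (Lyons and Peres), which may be used: for all $d\ge 3$, with $T_d$ the $d$-regular tree, $p_u(T_d\Box\mathbb{Z})\ge\left(\sqrt{d-1}+1+\sqrt{2\sqrt{d-1}-1}\right)^{-1}$. *)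

theory Defs
  imports "HOL-Probability.Probability"
begin

record 'v sgraph =
  verts :: "'v set"
  edges :: "'v set set"

definition simple_graph :: "'v sgraph \<Rightarrow> bool" where
  "simple_graph G \<longleftrightarrow>
     (\<forall>e\<in>edges G. \<exists>u\<in>verts G. \<exists>v\<in>verts G. u \<noteq> v \<and> e = {u, v})"

definition vdegree :: "'v sgraph \<Rightarrow> 'v \<Rightarrow> nat" where
  "vdegree G v = card {e \<in> edges G. v \<in> e}"

definition reachable :: "'v sgraph \<Rightarrow> 'v \<Rightarrow> 'v \<Rightarrow> bool" where
  "reachable G = (\<lambda>u v. {u, v} \<in> edges G)\<^sup>*\<^sup>*"

definition graph_connected :: "'v sgraph \<Rightarrow> bool" where
  "graph_connected G \<longleftrightarrow>
     verts G \<noteq> {} \<and> (\<forall>u\<in>verts G. \<forall>v\<in>verts G. reachable G u v)"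

definition is_cycle :: "'v sgraph \<Rightarrow> 'v list \<Rightarrow> bool" where
  "is_cycle G vs \<longleftrightarrow> 3 \<le> length vs \<and> distinct vs \<and>
     (\<forall>i<length vs. {vs ! i, vs ! (Suc i mod length vs)} \<in> edges G)"

definition is_tree :: "'v sgraph \<Rightarrow> bool" where
  "is_tree G \<longleftrightarrow> simple_graph G \<and> graph_connected G \<and> (\<nexists>vs. is_cycle G vs)"

text \<open>For \<open>d \<ge> 1\<close> the vertex degree being \<open>d\<close> entails that only finitely many
  edges meet the vertex, as the cardinality of an infinite set is \<open>0\<close>.\<close>

definition regular_tree :: "nat \<Rightarrow> 'v sgraph \<Rightarrow> bool" where
  "regular_tree d T \<longleftrightarrow>
     is_tree T \<and> infinite (verts T) \<and> (\<forall>v\<in>verts T. vdegree T v = d)"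

definition int_line :: "int sgraph" where
  "int_line = \<lparr>verts = UNIV, edges = {{k, k + 1} | k. True}\<rparr>"

definition cart_prod :: "'a sgraph \<Rightarrow> 'b sgraph \<Rightarrow> ('a \<times> 'b) sgraph"  (infixr "\<box>" 75) where
  "G \<box> H = \<lparr>verts = verts G \<times> verts H,
     edges = {{(u, k), (v, l)} | u v k l.
       (u, k) \<in> verts G \<times> verts H \<and> (v, l) \<in> verts G \<times> verts H \<and>
       (u = v \<and> {k, l} \<in> edges H \<or> {u, v} \<in> edges G \<and> k = l)}\<rparr>"

definition graph_components :: "'v sgraph \<Rightarrow> 'v set set" where
  "graph_components G = {{u \<in> verts G. reachable G v u} | v. v \<in> verts G}"

text \<open>A configuration maps each edge to \<open>True\<close> (open) or \<open>False\<close> (closed).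
  For \<open>p\<close> outside \<open>[0,1]\<close> the library's \<open>bernoulli_pmf\<close> truncates the parameter;
  the thresholds below only use \<open>p \<in> [0,1]\<close>.\<close>

definition percolation :: "'v sgraph \<Rightarrow> real \<Rightarrow> ('v set \<Rightarrow> bool) measure" where
  "percolation G p = (\<Pi>\<^sub>M e\<in>edges G. measure_pmf (bernoulli_pmf p))"

definition open_subgraph :: "'v sgraph \<Rightarrow> ('v set \<Rightarrow> bool) \<Rightarrow> 'v sgraph" where
  "open_subgraph G \<omega> = \<lparr>verts = verts G, edges = {e \<in> edges G. \<omega> e}\<rparr>"

definition clusters :: "'v sgraph \<Rightarrow> ('v set \<Rightarrow> bool) \<Rightarrow> 'v set set" where
  "clusters G \<omega> = graph_components (open_subgraph G \<omega>)"

definition p_c :: "'v sgraph \<Rightarrow> real" where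
  "p_c G = Inf {p \<in> {0..1}. AE \<omega> in percolation G p. \<exists>C\<in>clusters G \<omega>. infinite C}"

definition p_u :: "'v sgraph \<Rightarrow> real" where
  "p_u G = Inf {p \<in> {0..1}. AE \<omega> in percolation G p. \<exists>!C. C \<in> clusters G \<omega> \<and> infinite C}"

end

(*
For p_c, explore from a column {v} x Z towards the children of v in the tree, keeping track of the
set B of sites of the column that have been reached. The potential 1 - s^|B| with s = 0.9 has
expectation at least 1.0035/3 times its old value in each single child at p = 0.2249. As every
vertex has three children with independent explorations, the probability to survive n levels is
at least 0.01 * (1 - s^|B|) for all n, by induction on n. Infinitely many disjoint subtrees make
an infinite cluster almost sure.

For p_u, a supersolution built from the weight 3^(-depth/2) shows that the expected number of open
self-avoiding paths from (o,k) to (o,l) decays exponentially in |k - l| when p <= 0.2324. If the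
infinite cluster were unique, (o,k) and (o,l) would be connected whenever both lie in infinite
clusters. These events have the same probability for all k, by translation, so that their
probability is 0 by inclusion-exclusion over many far apart heights; as o is arbitrary, there is
no infinite cluster at all.
*)

theory Submission
  imports Defs
begin

text \<open>The expected number of reached sites is no usable potential. In a child of a long, fully
  reached interval a site is reached with probability 1 - (1-p)^3 / (1 - p*(1-p))^2, about 0.317 <
  1/3 at p = 0.2249, so dense sets shrink on average, although a single site yields p*(1+p)/(1-p),
  about 0.355, sites per child. The potential 1 - s^|B| saturates, so losses from large sets cost
  little. For uniqueness, the weight 3^(-depth/2) balances the two tree directions: relative to the
  vertex itself, the parent and the three children each contribute sqrt 3. It equals 1 at both ends
  of a path from (o,k) to (o,l), so it bounds their number without loss there. The supersolution
  works up to the smaller root of p * (2 * sqrt 3 + 2 - 5 * p) = 1, which is 1 / (sqrt 3 + 1 + sqrt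
  (2 * sqrt 3 - 1)) = 0.23246...; hence 0.2324. Inclusion-exclusion takes the place of the usual
  Harris inequality, so that translation invariance is the only structural property of the measure
  needed there.\<close>

section \<open>Numerical invariant of the exploration\<close>

text \<open>Here \<open>2249/10000 = p\<close> is the edge probability, \<open>9/10 = s\<close> is the base of the weight \<open>s ^ card C\<close>
  of an occupied set \<open>C\<close>, and \<open>77510/79759 = (1 - p) / (1 - p * s)\<close>. The quantities \<open>a\<close>, \<open>c\<close>, \<open>t\<close>
  are the expected weights that \<open>scan_recursion\<close> below computes along a column, and \<open>n\<close> counts the sites
  scanned so far that are occupied in the previous column. A site that is not occupied leaves
  \<open>a + 77510/79759 * t\<close> unchanged. The cases \<open>n = 0\<close> and \<open>n = 1\<close> need sharper bounds
  than the generic case: the first losses are the smallest relative to what is required.\<close>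

definition scan_inv :: "nat \<Rightarrow> real \<Rightarrow> real \<Rightarrow> real \<Rightarrow> bool" where
  "scan_inv n a c t \<longleftrightarrow> 0 \<le> c \<and> c \<le> 9/10 * a \<and> 0 \<le> t \<and>
     a + 77510/79759 * t \<le> 1 - 335/1000 * (1 - (9/10) ^ n) \<and>
     (n = 0 \<longrightarrow> a = 1 \<and> t = 0 \<and> 8746/10000 \<le> c \<and> c \<le> 8747/10000) \<and>
     (n = 1 \<longrightarrow> 966/1000 \<le> a + 77510/79759 * t \<and>
        182/1000 \<le> a - 77510/79759 * (9/10) * c \<and> 67/100 \<le> c) \<and>
     (2 \<le> n \<longrightarrow> 154/1000 * (a + 77510/79759 * t) \<le> a - 77510/79759 * (9/10) * c \<and>
        114/100 * (9/10) ^ n \<le> a + 77510/79759 * t)"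

text \<open>Before the first occupied site, \<open>c\<close> contracts to its fixed point (9/10) *
  77510/79759 = 0.87462..., which the interval [0.8746, 0.8747] encloses.\<close>

lemma scan_inv_gap:
  assumes "scan_inv n a c t"
  shows "scan_inv n (2249/10000 * a + 7751/10000 * (a + t))
    (9/10 * (2249/10000 * c + 7751/10000 * (a + t))) (9/10 * (2249/10000) * t)"
proof -
  define X :: real where "X = (9/10) ^ n"
  note inv = assms[unfolded scan_inv_def X_def[symmetric]]
  consider "n = 0" | "n = 1" | "2 \<le> n" by linarith
  then show ?thesis
  proof cases
    case 1
    then have "X = 1" by (simp add: X_def)
    moreover from inv 1 have "a = 1" "t = 0" "8746/10000 \<le> c" "c \<le> 8747/10000" by blast+
    ultimately show ?thesis
      using 1 unfolding scan_inv_def X_def[symmetric] distrib_left right_diff_distrib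
      by (intro conjI impI) linarith+
  next
    case 2
    from inv 2 have "0 \<le> c" "c \<le> 9/10 * a" "0 \<le> t" "a + 77510/79759 * t \<le> 1 - 335/1000 * (1 - X)"
      "966/1000 \<le> a + 77510/79759 * t"
      "182/1000 \<le> a - 77510/79759 * (9/10) * c" "67/100 \<le> c" by blast+
    with 2 show ?thesis
      unfolding scan_inv_def X_def[symmetric] distrib_left right_diff_distrib
      by (intro conjI impI) linarith+
  next
    case 3
    with inv have "0 \<le> c" "c \<le> 9/10 * a" "0 \<le> t" "a + 77510/79759 * t \<le> 1 - 335/1000 * (1 - X)"
      "154/1000 * (a + 77510/79759 * t) \<le> a - 77510/79759 * (9/10) * c"
      "114/100 * X \<le> a + 77510/79759 * t" by blast+
    with 3 show ?thesis
      unfolding scan_inv_def X_def[symmetric] distrib_left right_diff_distrib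
      by (intro conjI impI) linarith+
  qed
qed

text \<open>Write p = 0.2249 and \<kappa> = 77510/79759. An occupied site lowers a + \<kappa>*t by
  exactly p * (p * (a - \<kappa>*(9/10)*c) + (1-p) * (1 - \<kappa>*(9/10)) * (a + t)), while the
  upper bound to be maintained falls by 0.0335 * (9/10)^n. For 2 \<le> n the factor 0.154 makes this
  loss at least 0.0296 * (a + \<kappa>*t), and the factor 1.14 makes that enough.\<close>

lemma scan_inv_hit:
  assumes "scan_inv n a c t"
  shows "scan_inv (Suc n) (7751/10000 * (2249/10000 * a + 7751/10000 * (a + t)))
    (7751/10000 * (9/10 * (2249/10000 * c + 7751/10000 * (a + t))))
    (9/10 * (2249/10000) * t + 2249/10000 * (9/10 * (2249/10000 * c + 7751/10000 * (a + t))))"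
proof -
  define X :: real where "X = (9/10) ^ n"
  have X': "(9/10) ^ Suc n = 9/10 * X" by (simp add: X_def)
  note inv = assms[unfolded scan_inv_def X_def[symmetric]]
  consider "n = 0" | "n = 1" | "2 \<le> n" by linarith
  then show ?thesis
  proof cases
    case 1
    then have "X = 1" by (simp add: X_def)
    moreover have "a = 1" "t = 0" "8746/10000 \<le> c" "c \<le> 8747/10000" using inv 1 by blast+
    ultimately show ?thesis
      using 1 unfolding scan_inv_def X' distrib_left right_diff_distrib
      by (intro conjI impI) linarith+
  next
    case 2
    then have "X = 9/10" by (simp add: X_def)
    moreover from inv 2 have "0 \<le> c" "c \<le> 9/10 * a" "0 \<le> t" "a + 77510/79759 * t \<le> 1 - 335/1000 * (1 - X)"
      "966/1000 \<le> a + 77510/79759 * t"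
      "182/1000 \<le> a - 77510/79759 * (9/10) * c" "67/100 \<le> c" by blast+
    ultimately show ?thesis
      using 2 unfolding scan_inv_def X' distrib_left right_diff_distrib
      by (intro conjI impI) linarith+
  next
    case 3
    with inv have "0 \<le> c" "c \<le> 9/10 * a" "0 \<le> t" "a + 77510/79759 * t \<le> 1 - 335/1000 * (1 - X)"
      "154/1000 * (a + 77510/79759 * t) \<le> a - 77510/79759 * (9/10) * c"
      "114/100 * X \<le> a + 77510/79759 * t" by blast+
    with 3 show ?thesis
      unfolding scan_inv_def X' distrib_left right_diff_distrib
      by (intro conjI impI) linarith+
  qed
qed

section \<open>Finite Bernoulli expectations\<close>

text \<open>The expectation of \<open>f S\<close> for a random subset \<open>S\<close> of \<open>F\<close> that contains each
  element independently with probability \<open>p\<close>.\<close>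

definition bexp :: "real \<Rightarrow> 'e set \<Rightarrow> ('e set \<Rightarrow> real) \<Rightarrow> real" where
  "bexp p F f = (\<Sum>S\<in>Pow F. p ^ card S * (1 - p) ^ card (F - S) * f S)"

lemma bexp_empty [simp]: "bexp p {} f = f {}"
  by (simp add: bexp_def)

lemma bexp_insert:
  assumes "finite F" "e \<notin> F"
  shows "bexp p (insert e F) f = p * bexp p F (\<lambda>S. f (insert e S)) + (1 - p) * bexp p F f"
proof -
  have disj: "Pow F \<inter> insert e ` Pow F = {}" using assms(2) by auto
  have inj: "inj_on (insert e) (Pow F)"
    using assms(2) by (auto simp: inj_on_def)
  have 1: "card (insert e F - S) = Suc (card (F - S))" if "S \<in> Pow F" for S
  proof -
    have "insert e F - S = insert e (F - S)" using that assms(2) by auto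
    then show ?thesis using assms by (simp add: finite_Diff)
  qed
  have 2: "card (insert e S) = Suc (card S)" "insert e F - insert e S = F - S" if "S \<in> Pow F" for S
  proof -
    have "finite S" "e \<notin> S" using that assms by (auto dest: finite_subset)
    then show "card (insert e S) = Suc (card S)" by simp
    show "insert e F - insert e S = F - S" using assms(2) by auto
  qed
  have "bexp p (insert e F) f =
      (\<Sum>S\<in>Pow F. p ^ card S * (1 - p) ^ card (insert e F - S) * f S) +
      (\<Sum>S\<in>Pow F. p ^ card (insert e S) * (1 - p) ^ card (insert e F - insert e S) * f (insert e S))"
    unfolding bexp_def Pow_insert using assms(1) disj
    by (subst sum.union_disjoint) (auto simp: sum.reindex[OF inj] o_def)
  also have "\<dots> = (1 - p) * bexp p F f + p * bexp p F (\<lambda>S. f (insert e S))"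
    unfolding bexp_def sum_distrib_left
    by (intro arg_cong2[of _ _ _ _ "(+)"] sum.cong refl) (simp_all only: 1 2 power_Suc ac_simps)
  finally show ?thesis by simp
qed

lemma bexp_cong:
  "(\<And>S. S \<subseteq> F \<Longrightarrow> f S = g S) \<Longrightarrow> bexp p F f = bexp p F g"
  by (auto simp: bexp_def intro!: sum.cong)

lemma bexp_add: "bexp p F (\<lambda>S. f S + g S) = bexp p F f + bexp p F g"
  by (simp add: bexp_def sum.distrib algebra_simps)

lemma bexp_diff: "bexp p F (\<lambda>S. f S - g S) = bexp p F f - bexp p F g"
  by (simp add: bexp_def sum_subtractf algebra_simps)

lemma bexp_cmult: "bexp p F (\<lambda>S. c * f S) = c * bexp p F f"
  by (simp add: bexp_def sum_distrib_left algebra_simps)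

lemma bexp_mono:
  assumes "0 \<le> p" "p \<le> 1" "\<And>S. S \<subseteq> F \<Longrightarrow> f S \<le> g S"
  shows "bexp p F f \<le> bexp p F g"
  unfolding bexp_def using assms by (intro sum_mono mult_left_mono) auto

lemma bexp_const: "finite F \<Longrightarrow> bexp p F (\<lambda>S. c) = c"
  by (induction rule: finite_induct) (auto simp: bexp_insert algebra_simps)

lemma bexp_Un:
  assumes "finite F" "finite G" "F \<inter> G = {}"
  shows "bexp p (F \<union> G) f = bexp p F (\<lambda>S. bexp p G (\<lambda>S'. f (S \<union> S')))"
  using assms
proof (induction arbitrary: f rule: finite_induct)
  case (insert e F)
  have IH: "bexp p (F \<union> G) g = bexp p F (\<lambda>S. bexp p G (\<lambda>S'. g (S \<union> S')))" for g
    using insert.IH insert.prems by simp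
  have "bexp p (insert e F \<union> G) f =
      p * bexp p (F \<union> G) (\<lambda>S. f (insert e S)) + (1 - p) * bexp p (F \<union> G) f"
    using insert.hyps insert.prems by (simp add: bexp_insert)
  also have "\<dots> = bexp p (insert e F) (\<lambda>S. bexp p G (\<lambda>S'. f (S \<union> S')))"
    unfolding IH using insert.hyps by (simp add: bexp_insert)
  finally show ?case .
qed simp

text \<open>Independence over disjoint coordinate sets; the last assumption says that
  \<open>f i\<close> looks at \<open>F i\<close> only. It serves to factorise the event that no
  branch survives.\<close>

lemma bexp_prod:
  assumes "finite I" "\<And>i. i \<in> I \<Longrightarrow> finite (F i)"
    "\<And>i j. i \<in> I \<Longrightarrow> j \<in> I \<Longrightarrow> i \<noteq> j \<Longrightarrow> F i \<inter> F j = {}"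
    "\<And>i S. i \<in> I \<Longrightarrow> f i S = f i (S \<inter> F i)"
  shows "bexp p (\<Union>i\<in>I. F i) (\<lambda>S. \<Prod>i\<in>I. f i S) = (\<Prod>i\<in>I. bexp p (F i) (f i))"
  using assms
proof (induction rule: finite_induct)
  case (insert i I)
  have fin: "finite (F i)" "finite (\<Union>j\<in>I. F j)"
    using insert.prems(1) insert.hyps(1) by auto
  have disj: "F i \<inter> (\<Union>j\<in>I. F j) = {}" using insert.prems(2)[of i] insert.hyps(2) by fastforce
  have IH: "bexp p (\<Union>i\<in>I. F i) (\<lambda>S. \<Prod>i\<in>I. f i S) = (\<Prod>i\<in>I. bexp p (F i) (f i))"
    by (rule insert.IH) (use insert.prems in blast)+
  have "bexp p (\<Union>j\<in>insert i I. F j) (\<lambda>S. \<Prod>j\<in>insert i I. f j S) =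
      bexp p (F i \<union> (\<Union>j\<in>I. F j)) (\<lambda>S. f i S * (\<Prod>j\<in>I. f j S))"
    using insert.hyps by simp
  also have "\<dots> = bexp p (F i) (\<lambda>S. bexp p (\<Union>j\<in>I. F j) (\<lambda>S'. f i (S \<union> S') * (\<Prod>j\<in>I. f j (S \<union> S'))))"
    by (rule bexp_Un[OF fin disj])
  also have "\<dots> = bexp p (F i) (\<lambda>S. bexp p (\<Union>j\<in>I. F j) (\<lambda>S'. f i S * (\<Prod>j\<in>I. f j S')))"
  proof (intro bexp_cong arg_cong2[of _ _ _ _ "(*)"] prod.cong refl)
    fix S S' assume *: "S \<subseteq> F i" "S' \<subseteq> (\<Union>j\<in>I. F j)"
    have "(S \<union> S') \<inter> F i = S" using * disj by blast
    then show "f i (S \<union> S') = f i S" using insert.prems(3)[of i "S \<union> S'"] by simp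
    fix j assume j: "j \<in> I"
    have "F i \<inter> F j = {}" using disj j by auto
    then have "(S \<union> S') \<inter> F j = S' \<inter> F j" using * by blast
    then show "f j (S \<union> S') = f j S'"
      using insert.prems(3)[of j S'] insert.prems(3)[of j "S \<union> S'"] j by simp
  qed
  also have "\<dots> = bexp p (F i) (f i) * bexp p (\<Union>j\<in>I. F j) (\<lambda>S'. \<Prod>j\<in>I. f j S')"
  proof -
    have "bexp p (F i) (\<lambda>S. f i S * c) = bexp p (F i) (f i) * c" for c
      using bexp_cmult[of p "F i" c "f i"] by (simp add: mult.commute)
    then show ?thesis by (simp add: bexp_cmult)
  qed
  finally show ?case using IH insert.hyps by simp
qed simp

section \<open>Exploring one column\<close>

text \<open>A column is scanned upwards. The state after the site \<open>k\<close> is \<open>(C, K, b)\<close>: the set \<open>C\<close> of sites found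
  so far to be connected to \<open>B\<close>, whether the current run of open column edges, the one
  ending in \<open>k\<close>, is connected to \<open>B\<close> (\<open>b\<close>), and the sites \<open>K\<close> of that run if it is not.
  In a step, \<open>x\<close> says that the column edge below \<open>k\<close> is open and \<open>h\<close> that the edge from \<open>k\<close> to the
  previous column is open and starts in \<open>B\<close>. The label \<open>(w, False, k)\<close> stands for the edge from \<open>k\<close> to
  \<open>k + 1\<close> of the column \<open>w\<close>, and \<open>(w, True, k)\<close> for its edge at height \<open>k\<close> to the previous column.\<close>

fun scan_step :: "bool \<Rightarrow> bool \<Rightarrow> int \<Rightarrow> int set \<times> int set \<times> bool \<Rightarrow> int set \<times> int set \<times> bool" where
  "scan_step x h k (C, K, b) =
     (if x then
        if b then (insert k C, {}, True)
        else if h then (C \<union> insert k K, {}, True) else (C, insert k K, False)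
      else if h then (insert k C, {}, True) else (C, {k}, False))"

primrec scan :: "'w \<Rightarrow> int set \<Rightarrow> int \<Rightarrow> nat \<Rightarrow> ('w \<times> bool \<times> int) set \<Rightarrow> int set \<times> int set \<times> bool" where
  "scan w B L 0 S = ({}, {L}, False)"
| "scan w B L (Suc n) S =
     scan_step ((w, False, L + int n) \<in> S) (L + int (Suc n) \<in> B \<and> (w, True, L + int (Suc n)) \<in> S)
       (L + int (Suc n)) (scan w B L n S)"

primrec scan_labels :: "'w \<Rightarrow> int \<Rightarrow> nat \<Rightarrow> ('w \<times> bool \<times> int) set" where
  "scan_labels w L 0 = {}"
| "scan_labels w L (Suc n) =
     insert (w, False, L + int n) (insert (w, True, L + int (Suc n)) (scan_labels w L n))"

lemma finite_scan_labels [simp]: "finite (scan_labels w L n)"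
  by (induction n) auto

lemma scan_labels_subset: "scan_labels w L n \<subseteq> {(w, False, k) | k. k < L + int n} \<union> {(w, True, k) | k. k \<le> L + int n}"
  by (induction n) auto

lemma scan_labels_fst: "l \<in> scan_labels w L n \<Longrightarrow> fst l = w"
  by (induction n) auto

lemma scan_inter: "scan_labels w L n \<subseteq> F \<Longrightarrow> scan w B L n (S \<inter> F) = scan w B L n S"
  by (induction n) auto

lemma scan_wf:
  assumes "scan w B L n S = (C, K, b)"
  shows "C \<subseteq> {L..L + int n}" "K \<subseteq> {L..L + int n}" "C \<inter> K = {}" "b \<Longrightarrow> K = {}"
proof -
  have "(\<forall>j\<in>C. L \<le> j \<and> j \<le> L + int n) \<and> (\<forall>j\<in>K. L \<le> j \<and> j \<le> L + int n) \<and>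
      C \<inter> K = {} \<and> (b \<longrightarrow> K = {})"
    using assms
  proof (induction n arbitrary: C K b)
    case (Suc n)
    obtain C' K' b' where st: "scan w B L n S = (C', K', b')" by (cases "scan w B L n S")
    show ?case
      using Suc.prems Suc.IH[OF st] unfolding scan.simps st scan_step.simps
      by (auto split: if_splits)
  qed auto
  then show "C \<subseteq> {L..L + int n}" "K \<subseteq> {L..L + int n}" "C \<inter> K = {}" "b \<Longrightarrow> K = {}" by auto
qed

text \<open>The two labels of the new site are fresh, so the scan state is a Markov chain and one
  step averages over four outcomes.\<close>

lemma bexp_scan_Suc:
  fixes w :: 'w
  shows "bexp p (scan_labels w L (Suc n)) (\<lambda>S. f (scan w B L (Suc n) S)) =
    bexp p (scan_labels w L n) (\<lambda>S.
      let k = L + int (Suc n); h = (k \<in> B); x = scan w B L n S in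
      p * (p * f (scan_step True h k x) + (1 - p) * f (scan_step True False k x)) +
      (1 - p) * (p * f (scan_step False h k x) + (1 - p) * f (scan_step False False k x)))"
proof -
  let ?k = "L + int (Suc n)"
  let ?F = "scan_labels w L n"
  have new: "(w, False, L + int n) \<notin> insert (w, True, ?k) ?F" "(w, True, ?k) \<notin> ?F"
    using scan_labels_subset[of w L n] by auto
  have old: "scan w B L n S' = scan w B L n S" if "S' \<inter> ?F = S \<inter> ?F" for S S'
    using scan_inter[of w L n ?F B] that by (metis order_refl)
  have *: "scan w B L (Suc n) (insert (w, False, L + int n) (insert (w, True, ?k) S)) = scan_step True (?k \<in> B) ?k (scan w B L n S)"
    "scan w B L (Suc n) (insert (w, False, L + int n) S) = scan_step True False ?k (scan w B L n S)"
    "scan w B L (Suc n) (insert (w, True, ?k) S) = scan_step False (?k \<in> B) ?k (scan w B L n S)"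
    "scan w B L (Suc n) S = scan_step False False ?k (scan w B L n S)"
    if S: "S \<subseteq> ?F" for S
  proof -
    have o: "scan w B L n (insert (w, False, L + int n) (insert (w, True, ?k) S)) = scan w B L n S"
      "scan w B L n (insert (w, False, L + int n) S) = scan w B L n S"
      "scan w B L n (insert (w, True, ?k) S) = scan w B L n S"
      by (rule old; use new in auto)+
    have "(w, False, L + int n) \<notin> S" "(w, True, ?k) \<notin> S" using S new by auto
    then show "scan w B L (Suc n) (insert (w, False, L + int n) (insert (w, True, ?k) S)) = scan_step True (?k \<in> B) ?k (scan w B L n S)"
    "scan w B L (Suc n) (insert (w, False, L + int n) S) = scan_step True False ?k (scan w B L n S)"
    "scan w B L (Suc n) (insert (w, True, ?k) S) = scan_step False (?k \<in> B) ?k (scan w B L n S)"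
    "scan w B L (Suc n) S = scan_step False False ?k (scan w B L n S)"
      unfolding scan.simps o by simp_all
  qed
  have "bexp p (scan_labels w L (Suc n)) (\<lambda>S. f (scan w B L (Suc n) S)) =
    p * (p * bexp p ?F (\<lambda>S. f (scan w B L (Suc n) (insert (w, False, L + int n) (insert (w, True, ?k) S))))
       + (1 - p) * bexp p ?F (\<lambda>S. f (scan w B L (Suc n) (insert (w, False, L + int n) S)))) +
    (1 - p) * (p * bexp p ?F (\<lambda>S. f (scan w B L (Suc n) (insert (w, True, ?k) S)))
       + (1 - p) * bexp p ?F (\<lambda>S. f (scan w B L (Suc n) S)))"
    unfolding scan_labels.simps
    by (subst bexp_insert; (use new in simp; fail)?)+
  also have "\<dots> = p * (p * bexp p ?F (\<lambda>S. f (scan_step True (?k \<in> B) ?k (scan w B L n S)))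
       + (1 - p) * bexp p ?F (\<lambda>S. f (scan_step True False ?k (scan w B L n S)))) +
    (1 - p) * (p * bexp p ?F (\<lambda>S. f (scan_step False (?k \<in> B) ?k (scan w B L n S)))
       + (1 - p) * bexp p ?F (\<lambda>S. f (scan_step False False ?k (scan w B L n S))))"
    by (intro arg_cong2[of _ _ _ _ "(+)"] arg_cong2[of _ _ _ _ "(*)"] refl bexp_cong arg_cong[of _ _ f] *)
  finally show ?thesis unfolding Let_def bexp_add bexp_cmult .
qed

text \<open>Three weights are needed for a closed linear recursion. \<open>wa\<close> and
  \<open>wt\<close> split the weight of \<open>C\<close> by whether the current run is attached;
  \<open>wc\<close> is the weight that an unattached run would leave if it became attached
  now.\<close>

fun wa :: "real \<Rightarrow> int set \<times> int set \<times> bool \<Rightarrow> real" where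
  "wa s (C, K, b) = (if b then 0 else s ^ card C)"
fun wc :: "real \<Rightarrow> int set \<times> int set \<times> bool \<Rightarrow> real" where
  "wc s (C, K, b) = (if b then 0 else s ^ (card C + card K))"
fun wt :: "real \<Rightarrow> int set \<times> int set \<times> bool \<Rightarrow> real" where
  "wt s (C, K, b) = (if b then s ^ card C else 0)"

lemma weights_step:
  fixes S :: "('w \<times> bool \<times> int) set" and L :: int and n :: nat and w :: 'w and B :: "int set"
  defines "k \<equiv> L + int (Suc n)" and "x \<equiv> scan w B L n S"
  shows "wa s (scan_step True h k x) = (if h then 0 else wa s x)"
    and "wa s (scan_step False h k x) = (if h then 0 else wa s x + wt s x)"
    and "wc s (scan_step True h k x) = (if h then 0 else s * wc s x)"
    and "wc s (scan_step False h k x) = (if h then 0 else s * (wa s x + wt s x))"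
    and "wt s (scan_step True h k x) = s * wt s x + (if h then s * wc s x else 0)"
    and "wt s (scan_step False h k x) = (if h then s * (wa s x + wt s x) else 0)"
proof -
  obtain C K b where st: "scan w B L n S = (C, K, b)" by (cases "scan w B L n S")
  note wf = scan_wf[OF st]
  have x: "x = (C, K, b)" by (simp add: x_def st)
  have fin: "finite C" "finite K" using wf(1,2) by (auto intro: finite_subset)
  have k: "k \<notin> C" "k \<notin> K" using wf(1,2) by (auto simp: k_def)
  have u: "card (C \<union> insert k K) = Suc (card C + card K)"
    using wf(3) fin k by (subst card_Un_disjoint) auto
  have u': "card (C \<union> K) = card C + card K"
    using wf(3) fin by (rule_tac card_Un_disjoint) auto
  note [simp] = x fin k u u'
  show "wa s (scan_step True h k x) = (if h then 0 else wa s x)"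
    "wa s (scan_step False h k x) = (if h then 0 else wa s x + wt s x)"
    "wc s (scan_step True h k x) = (if h then 0 else s * wc s x)"
    "wc s (scan_step False h k x) = (if h then 0 else s * (wa s x + wt s x))"
    "wt s (scan_step True h k x) = s * wt s x + (if h then s * wc s x else 0)"
    "wt s (scan_step False h k x) = (if h then s * (wa s x + wt s x) else 0)"
    by auto
qed

text \<open>Of \<open>B\<close> only the membership of the current site enters, which reduces all
  sets \<open>B\<close> to sequences of two linear maps.\<close>

lemma scan_recursion:
  fixes w :: 'w
  assumes a: "a = (\<lambda>n. bexp p (scan_labels w L n) (\<lambda>S. wa s (scan w B L n S)))"
    and c: "c = (\<lambda>n. bexp p (scan_labels w L n) (\<lambda>S. wc s (scan w B L n S)))"
    and t: "t = (\<lambda>n. bexp p (scan_labels w L n) (\<lambda>S. wt s (scan w B L n S)))"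
  shows "a 0 = 1" "c 0 = s" "t 0 = 0"
    and "L + int (Suc n) \<notin> B \<Longrightarrow> a (Suc n) = p * a n + (1 - p) * (a n + t n)"
    and "L + int (Suc n) \<notin> B \<Longrightarrow> c (Suc n) = s * (p * c n + (1 - p) * (a n + t n))"
    and "L + int (Suc n) \<notin> B \<Longrightarrow> t (Suc n) = s * p * t n"
    and "L + int (Suc n) \<in> B \<Longrightarrow> a (Suc n) = (1 - p) * (p * a n + (1 - p) * (a n + t n))"
    and "L + int (Suc n) \<in> B \<Longrightarrow> c (Suc n) = (1 - p) * (s * (p * c n + (1 - p) * (a n + t n)))"
    and "L + int (Suc n) \<in> B \<Longrightarrow>
      t (Suc n) = s * p * t n + p * (s * (p * c n + (1 - p) * (a n + t n)))"
  unfolding a c t bexp_scan_Suc Let_def weights_step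
  by (simp_all add: bexp_add bexp_cmult bexp_const) (simp_all add: algebra_simps)

text \<open>The constant exceeds \<open>1/3\<close>: with three children per column the potential
  \<open>1 - (9/10) ^ card B\<close> grows on average, hence the exploration survives.
  Six free sites on both sides of \<open>B\<close> make the boundary effects negligible.\<close>

lemma scan_level:
  fixes r :: nat and w :: 'w
  assumes B: "B \<subseteq> {- int r..int r}"
  shows "bexp (2249/10000) (scan_labels w (- int r - 6) (2 * r + 12))
      (\<lambda>S. (9/10) ^ card (fst (scan w B (- int r - 6) (2 * r + 12) S)))
    \<le> 1 - 3345/10000 * (1 - (9/10) ^ card B)"
proof -
  define L where "L = - int r - 6"
  define a where "a = (\<lambda>n. bexp (2249/10000) (scan_labels w L n) (\<lambda>S. wa (9/10) (scan w B L n S)))"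
  define c where "c = (\<lambda>n. bexp (2249/10000) (scan_labels w L n) (\<lambda>S. wc (9/10) (scan w B L n S)))"
  define t where "t = (\<lambda>n. bexp (2249/10000) (scan_labels w L n) (\<lambda>S. wt (9/10) (scan w B L n S)))"
  note rec = scan_recursion[OF a_def c_def t_def]
  define N where "N n = card (B \<inter> {L..L + int n})" for n
  have fin: "finite B" using B finite_subset by blast
  have gap: "a (Suc n) = 2249/10000 * a n + 7751/10000 * (a n + t n)"
    "c (Suc n) = 9/10 * (2249/10000 * c n + 7751/10000 * (a n + t n))"
    "t (Suc n) = 9/10 * (2249/10000) * t n" "N (Suc n) = N n"
    if "L + int (Suc n) \<notin> B" for n
  proof -
    have "B \<inter> {L..L + int (Suc n)} = B \<inter> {L..L + int n}" 
      using that by (auto simp: order_le_less)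
    then show "N (Suc n) = N n" by (simp add: N_def)
  qed (use rec(4-6)[OF that] in simp_all)
  have hit: "a (Suc n) = 7751/10000 * (2249/10000 * a n + 7751/10000 * (a n + t n))"
    "c (Suc n) = 7751/10000 * (9/10 * (2249/10000 * c n + 7751/10000 * (a n + t n)))"
    "t (Suc n) = 9/10 * (2249/10000) * t n + 2249/10000 * (9/10 * (2249/10000 * c n + 7751/10000 * (a n + t n)))"
    "N (Suc n) = Suc (N n)"
    if "L + int (Suc n) \<in> B" for n
  proof -
    have "B \<inter> {L..L + int (Suc n)} = insert (L + int (Suc n)) (B \<inter> {L..L + int n})" 
      using that by auto
    then show "N (Suc n) = Suc (N n)" using fin by (simp add: N_def)
  qed (use rec(7-9)[OF that] in simp_all)
  have pad: "L + int (Suc n) \<notin> B" if "n < 5 \<or> 2 * r + 6 \<le> n" for n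
    using that B by (auto simp: L_def)
  \<comment> \<open>The site \<open>L + 5\<close> is \<open>- r - 1\<close>, the last one below the
    range of \<open>B\<close>; five free steps bring \<open>c\<close> into its starting
    interval.\<close>
  have inv: "scan_inv (N (5 + n)) (a (5 + n)) (c (5 + n)) (t (5 + n))" for n
  proof (induction n)
    case 0
    have g: "a (Suc n) = 2249/10000 * a n + 7751/10000 * (a n + t n)"
      "c (Suc n) = 9/10 * (2249/10000 * c n + 7751/10000 * (a n + t n))"
      "t (Suc n) = 9/10 * (2249/10000) * t n" "N (Suc n) = N n" if "n < 5" for n
      using gap[OF pad] that by blast+
    have "B \<inter> {L..L + int 0} = {}" using B by (auto simp: L_def)
    then have "N 0 = 0" by (simp add: N_def)
    then show ?case
      unfolding scan_inv_def by (simp add: eval_nat_numeral g rec(1-3))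
  next
    case (Suc n)
    then show ?case
    proof (cases "L + int (Suc (5 + n)) \<in> B")
      case True
      show ?thesis using scan_inv_hit[OF Suc] hit[OF True] by (simp only: add_Suc_right)
    next
      case False
      show ?thesis using scan_inv_gap[OF Suc] gap[OF False] by (simp only: add_Suc_right)
    qed
  qed
  \<comment> \<open>The site \<open>L + ?M\<close> is \<open>r\<close>, the last that can be
    occupied; from there on \<open>t\<close> shrinks geometrically.\<close>
  let ?M = "2 * r + 6"
  have bd: "t (?M + i) \<le> (9/10 * (2249/10000)) ^ i * t ?M" for i
  proof (induction i)
    case (Suc i)
    have "t (?M + Suc i) = 9/10 * (2249/10000) * t (?M + i)"
      using gap(3)[OF pad, of "?M + i"] by simp
    then show ?case using Suc by simp
  qed simp
  have "L + int (?M + 6) = int r + 6" by (simp add: L_def)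
  then have "B \<inter> {L..L + int (?M + 6)} = B" using B by (force simp: L_def)
  then have NB: "N (?M + 6) = card B" by (simp add: N_def)
  have I1: "scan_inv (N ?M) (a ?M) (c ?M) (t ?M)" using inv[of "2 * r + 1"] by (simp add: numeral_eq_Suc)
  have I2: "scan_inv (card B) (a (?M + 6)) (c (?M + 6)) (t (?M + 6))"
    using inv[of "2 * r + 7"] NB by (simp add: numeral_eq_Suc)
  have *: "bexp (2249/10000) (scan_labels w L (?M + 6)) (\<lambda>S. (9/10) ^ card (fst (scan w B L (?M + 6) S))) =
      a (?M + 6) + t (?M + 6)"
    unfolding a_def t_def bexp_add[symmetric]
  proof (rule bexp_cong)
    fix S
    show "(9/10) ^ card (fst (scan w B L (?M + 6) S)) =
      wa (9/10) (scan w B L (?M + 6) S) + wt (9/10) (scan w B L (?M + 6) S)"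
      by (cases "scan w B L (?M + 6) S") simp
  qed
  \<comment> \<open>The invariant bounds \<open>a + 77510/79759 * t\<close>. Passing to
    \<open>a + t\<close> costs less than 0.00003, and lowering 0.335 to 0.3345 gains at least 0.0005
    * 0.1 when \<open>B\<close> is nonempty.\<close>
  have "a (?M + 6) + t (?M + 6) \<le> 1 - 3345/10000 * (1 - (9/10) ^ card B)"
  proof (cases "card B = 0")
    case True
    then show ?thesis using I2 by (simp add: scan_inv_def)
  next
    case False
    then have X: "(9/10 :: real) ^ card B \<le> 9/10"
      using power_decreasing[of 1 "card B" "9/10 :: real"] by simp
    have "0 \<le> c ?M" "c ?M \<le> 9/10 * a ?M" "0 \<le> t ?M"
      "a ?M + 77510/79759 * t ?M \<le> 1 - 335/1000 * (1 - (9/10) ^ N ?M)"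
      using I1 by (auto simp: scan_inv_def)
    moreover have "0 \<le> 335/1000 * (1 - (9/10 :: real) ^ N ?M)" by (simp add: power_le_one)
    ultimately have "t ?M \<le> 79759/77510" by linarith
    then have "t (?M + 6) \<le> (9/10 * (2249/10000)) ^ 6 * (79759/77510)"
      using bd[of 6] by (meson order_trans mult_left_mono zero_le_power le_numeral_extra(3) zero_le_divide_iff zero_le_mult_iff zero_le_numeral)
    then have "t (?M + 6) \<le> 1/1000" by (simp add: power_divide power_mult_distrib)
    moreover have "a (?M + 6) + 77510/79759 * t (?M + 6) \<le> 1 - 335/1000 * (1 - (9/10) ^ card B)"
      using I2 by (simp add: scan_inv_def)
    ultimately show ?thesis using X unfolding right_diff_distrib by linarith
  qed
  moreover have "?M + 6 = 2 * r + 12" by simp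
  ultimately show ?thesis using * by (simp only: L_def)
qed

section \<open>Survival of the exploration\<close>

text \<open>The columns explored form a ternary tree of words, \<open>i # w\<close> being the \<open>i\<close>-th child of \<open>w\<close>. The exploration
  only moves away from the root, so that distinct children use disjoint sets of labels.\<close>

definition next_level :: "nat \<Rightarrow> 'w \<Rightarrow> int set \<Rightarrow> ('w \<times> bool \<times> int) set \<Rightarrow> int set" where
  "next_level r w B S = fst (scan w B (- int r - 6) (2 * r + 12) S)"

definition level_labels :: "nat \<Rightarrow> 'w \<Rightarrow> ('w \<times> bool \<times> int) set" where
  "level_labels r w = scan_labels w (- int r - 6) (2 * r + 12)"

primrec survive :: "nat \<Rightarrow> nat \<Rightarrow> nat list \<Rightarrow> int set \<Rightarrow> (nat list \<times> bool \<times> int) set \<Rightarrow> bool" where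
  "survive 0 r w B S = (B \<noteq> {})"
| "survive (Suc n) r w B S = (\<exists>i<3. survive n (r + 6) (i # w) (next_level r (i # w) B S) S)"

primrec survive_labels :: "nat \<Rightarrow> nat \<Rightarrow> nat list \<Rightarrow> (nat list \<times> bool \<times> int) set" where
  "survive_labels 0 r w = {}"
| "survive_labels (Suc n) r w =
     (\<Union>i<3. level_labels r (i # w) \<union> survive_labels n (r + 6) (i # w))"

lemma finite_level_labels [simp]: "finite (level_labels r w)"
  by (simp add: level_labels_def)

lemma finite_survive_labels [simp]: "finite (survive_labels n r w)"
  by (induction n arbitrary: r w) auto

lemma next_level_bounds: "next_level r w B S \<subseteq> {- int (r + 6)..int (r + 6)}"
proof -
  obtain C K b where st: "scan w B (- int r - 6) (2 * r + 12) S = (C, K, b)"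
    by (cases "scan w B (- int r - 6) (2 * r + 12) S")
  show ?thesis using scan_wf(1)[OF st] by (force simp: next_level_def st)
qed

lemma next_level_inter: "level_labels r w \<subseteq> F \<Longrightarrow> next_level r w B (S \<inter> F) = next_level r w B S"
  by (simp add: next_level_def level_labels_def scan_inter)

lemma level_labels_fst: "l \<in> level_labels r w \<Longrightarrow> fst l = w"
  unfolding level_labels_def by (rule scan_labels_fst)

text \<open>Words grow at the front, so a subtree is recognised by the suffix \<open>w\<close>; this
  is the source of all disjointness of labels.\<close>

lemma survive_labels_fst: "l \<in> survive_labels n r w \<Longrightarrow> \<exists>x. x \<noteq> [] \<and> fst l = x @ w"
proof (induction n arbitrary: r w)
  case (Suc n)
  then obtain i where "l \<in> level_labels r (i # w) \<or> l \<in> survive_labels n (r + 6) (i # w)" by auto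
  then show ?case
  proof
    assume "l \<in> level_labels r (i # w)"
    then have "fst l = [i] @ w" by (simp add: level_labels_fst)
    then show ?thesis by blast
  next
    assume "l \<in> survive_labels n (r + 6) (i # w)"
    from Suc.IH[OF this] obtain x where "fst l = (x @ [i]) @ w" by auto
    then show ?thesis by blast
  qed
qed simp

lemma survive_inter: "survive_labels n r w \<subseteq> F \<Longrightarrow> survive n r w B (S \<inter> F) = survive n r w B S"
proof (induction n arbitrary: r w B)
  case (Suc n)
  have "survive n (r + 6) (i # w) (next_level r (i # w) B (S \<inter> F)) (S \<inter> F) =
      survive n (r + 6) (i # w) (next_level r (i # w) B S) S" if "i < 3" for i
  proof -
    have "level_labels r (i # w) \<subseteq> F" "survive_labels n (r + 6) (i # w) \<subseteq> F"
      using Suc.prems that by auto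
    then show ?thesis using Suc.IH by (simp add: next_level_inter)
  qed
  then show ?case by auto
qed simp

lemma survive_probability:
  assumes "B \<subseteq> {- int r..int r}"
  shows "1/100 * (1 - (9/10) ^ card B) \<le> bexp (2249/10000) (survive_labels n r w) (\<lambda>S. of_bool (survive n r w B S))"
  using assms
proof (induction n arbitrary: r w B)
  case 0
  have "finite B" using 0 finite_subset by blast
  have "0 \<le> (9/10 :: real) ^ card B" by simp
  then have "- ((9/10 :: real) ^ card B) \<le> 99" by linarith
  then show ?case by (cases "B = {}") simp_all
next
  case (Suc n)
  let ?p = "2249/10000 :: real"
  define F where "F i = level_labels r (i # w) \<union> survive_labels n (r + 6) (i # w)" for i
  define A where "A i S \<longleftrightarrow> survive n (r + 6) (i # w) (next_level r (i # w) B S) S" for i S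
  define y :: real where "y = 3345/1000000 * (1 - (9/10) ^ card B)"
  have y: "0 \<le> y" "y \<le> 3345/1000000" by (auto simp: y_def power_le_one)
  have disj: "level_labels r v \<inter> survive_labels n (r + 6) v = {}" for v :: "nat list"
    using level_labels_fst survive_labels_fst by fastforce
  have xi: "y \<le> bexp ?p (F i) (\<lambda>S. of_bool (A i S))" for i
  proof -
    let ?w = "i # w"
    have "bexp ?p (F i) (\<lambda>S. of_bool (A i S)) =
        bexp ?p (level_labels r ?w) (\<lambda>S. bexp ?p (survive_labels n (r + 6) ?w) (\<lambda>S'. of_bool (A i (S \<union> S'))))"
      unfolding F_def by (rule bexp_Un) (simp_all add: disj)
    also have "\<dots> = bexp ?p (level_labels r ?w) (\<lambda>S. bexp ?p (survive_labels n (r + 6) ?w)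
        (\<lambda>S'. of_bool (survive n (r + 6) ?w (next_level r ?w B S) S')))"
    proof (intro bexp_cong)
      fix S S' assume S: "S \<subseteq> level_labels r ?w" "S' \<subseteq> survive_labels n (r + 6) ?w"
      have "(S \<union> S') \<inter> level_labels r ?w = S" "(S \<union> S') \<inter> survive_labels n (r + 6) ?w = S'"
        using S disj[of ?w] by blast+
      then have "next_level r ?w B (S \<union> S') = next_level r ?w B S"
        "survive n (r + 6) ?w C (S \<union> S') = survive n (r + 6) ?w C S'" for C
        using next_level_inter[OF order_refl, of r ?w B "S \<union> S'"]
          survive_inter[OF order_refl, of n "r + 6" ?w C "S \<union> S'"] by simp_all
      then show "of_bool (A i (S \<union> S')) = (of_bool (survive n (r + 6) ?w (next_level r ?w B S) S') :: real)"
        by (simp add: A_def)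
    qed
    \<comment> \<open>With the child column fixed, the induction hypothesis applies to its reached
      set, in a window wider by 6.\<close>
    also have "\<dots> \<ge> bexp ?p (level_labels r ?w) (\<lambda>S. 1/100 * (1 - (9/10) ^ card (next_level r ?w B S)))"
      by (intro bexp_mono Suc.IH next_level_bounds) auto
    also have "bexp ?p (level_labels r ?w) (\<lambda>S. 1/100 * (1 - (9/10) ^ card (next_level r ?w B S))) =
        1/100 * (1 - bexp ?p (level_labels r ?w) (\<lambda>S. (9/10) ^ card (next_level r ?w B S)))"
      unfolding bexp_cmult bexp_diff by (simp add: bexp_const)
    also have "\<dots> \<ge> y"
      using scan_level[OF Suc.prems, of ?w]
      unfolding y_def next_level_def level_labels_def right_diff_distrib by linarith
    finally show ?thesis .
  qed
  have "survive (Suc n) r w B S \<longleftrightarrow> (\<exists>i\<in>{..<3}. A i S)" for S by (auto simp: A_def)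
  then have ob: "of_bool (survive (Suc n) r w B S) = (1 - (\<Prod>i<3. 1 - of_bool (A i S)) :: real)" for S
    by (auto simp: prod_zero_iff)
  have eq: "bexp ?p (survive_labels (Suc n) r w) (\<lambda>S. of_bool (survive (Suc n) r w B S)) =
      1 - bexp ?p (\<Union>i\<in>{..<3}. F i) (\<lambda>S. \<Prod>i<3. 1 - of_bool (A i S))"
    unfolding ob bexp_diff by (simp add: bexp_const F_def)
  have "bexp ?p (\<Union>i\<in>{..<3}. F i) (\<lambda>S. \<Prod>i<3. 1 - of_bool (A i S)) =
      (\<Prod>i<3. bexp ?p (F i) (\<lambda>S. 1 - of_bool (A i S)))"
  proof (rule bexp_prod)
    fix i j :: nat assume "i \<noteq> j"
    have *: "\<exists>x. fst l = x @ (i # w)" if "l \<in> F i" for l i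
      using that level_labels_fst[of l r "i # w"] survive_labels_fst[of l n "r + 6" "i # w"]
      by (auto simp: F_def)
    show "F i \<inter> F j = {}"
    proof (rule ccontr)
      assume "F i \<inter> F j \<noteq> {}"
      then obtain l where "l \<in> F i" "l \<in> F j" by auto
      then obtain x x' where "fst l = x @ (i # w)" "fst l = x' @ (j # w)" using * by metis
      then show False using \<open>i \<noteq> j\<close> by simp
    qed
  next
    fix i S
    have "level_labels r (i # w) \<subseteq> F i" "survive_labels n (r + 6) (i # w) \<subseteq> F i" by (auto simp: F_def)
    then have "A i (S \<inter> F i) = A i S" by (simp add: A_def next_level_inter survive_inter)
    then show "1 - of_bool (A i S) = (1 - of_bool (A i (S \<inter> F i)) :: real)" by simp
  qed (auto simp: F_def)
  also have "\<dots> = (\<Prod>i<3. 1 - bexp ?p (F i) (\<lambda>S. of_bool (A i S)))"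
    by (simp add: bexp_diff bexp_const F_def)
  also have "\<dots> \<le> (\<Prod>i<(3::nat). 1 - y)"
  proof (rule prod_mono)
    fix i :: nat
    have "bexp ?p (F i) (\<lambda>S. of_bool (A i S)) \<le> bexp ?p (F i) (\<lambda>S. 1)" by (rule bexp_mono) auto
    also have "\<dots> = 1" by (simp add: bexp_const F_def)
    finally show "0 \<le> 1 - bexp ?p (F i) (\<lambda>S. of_bool (A i S)) \<and> 1 - bexp ?p (F i) (\<lambda>S. of_bool (A i S)) \<le> 1 - y"
      using xi[of i] by simp
  qed
  also have "\<dots> = (1 - y) ^ 3" by simp
  \<comment> \<open>The factor 1/100 keeps \<open>y\<close> below 0.003345, so the quadratic loss is
    smaller than the gain: 3 * 0.3345 * (1 - 0.003345) > 1.\<close>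
  also have "(1 - y) ^ 3 \<le> 1 - 1/100 * (1 - (9/10) ^ card B)"
  proof -
    have "(1 - y) ^ 3 = 1 - 3 * y * (1 - y) - y ^ 3" by (simp add: power3_eq_cube algebra_simps)
    moreover have "0 \<le> y ^ 3" using y by simp
    moreover have "3 * y * (1 - 3345/1000000) \<le> 3 * y * (1 - y)" using y by (intro mult_left_mono) auto
    moreover have "1/100 * (1 - (9/10) ^ card B) \<le> 3 * y * (1 - 3345/1000000)"
    proof -
      have "0 \<le> 1 - (9/10::real) ^ card B" by (simp add: power_le_one)
      then show ?thesis unfolding y_def by simp
    qed
    ultimately show ?thesis by linarith
  qed
  finally show ?case unfolding eq by linarith
qed

section \<open>Levels of the tree and an embedded ternary tree\<close>

section \<open>The regular tree\<close>

lemma rtranclp_simple_path: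
  assumes "R\<^sup>*\<^sup>* x y"
  shows "\<exists>xs. xs \<noteq> [] \<and> hd xs = x \<and> last xs = y \<and> distinct xs \<and> successively R xs"
  using assms
proof (induction rule: rtranclp_induct)
  case base
  show ?case by (rule exI[of _ "[x]"]) simp
next
  case (step y z)
  then obtain xs where xs: "xs \<noteq> []" "hd xs = x" "last xs = y" "distinct xs" "successively R xs" by blast
  show ?case
  proof (cases "z \<in> set xs")
    case True
    then obtain as bs where s: "xs = as @ z # bs" by (meson split_list)
    have "successively R (as @ [z])" using xs(5) unfolding s by (auto simp: successively_append_iff)
    moreover have "hd (as @ [z]) = x" using xs(2) unfolding s by (cases as) auto
    ultimately show ?thesis using xs(4) unfolding s by (intro exI[of _ "as @ [z]"]) auto
  next
    case False
    have "successively R (xs @ [z])" using xs step.hyps(2) by (auto simp: successively_append_iff)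
    then show ?thesis using xs False by (intro exI[of _ "xs @ [z]"]) auto
  qed
qed

locale rooted_tree =
  fixes T :: "'v sgraph" and rt :: 'v
  assumes tree: "regular_tree 4 T" and rt: "rt \<in> verts T"
begin

definition adj :: "'v \<Rightarrow> 'v \<Rightarrow> bool" where "adj u v \<longleftrightarrow> {u, v} \<in> edges T"

definition depth :: "'v \<Rightarrow> nat" where "depth v = (LEAST n. (adj ^^ n) rt v)"

lemma adj_sym: "adj u v \<Longrightarrow> adj v u"
  by (simp add: adj_def insert_commute)

lemma adj_verts: "adj u v \<Longrightarrow> u \<in> verts T \<and> v \<in> verts T \<and> u \<noteq> v"
  using tree unfolding regular_tree_def is_tree_def simple_graph_def adj_def
  by (metis doubleton_eq_iff insertCI)

lemma reach_rt: "v \<in> verts T \<Longrightarrow> adj\<^sup>*\<^sup>* rt v"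
  using tree rt unfolding regular_tree_def is_tree_def graph_connected_def reachable_def adj_def by auto

lemma depth_relpowp: "v \<in> verts T \<Longrightarrow> (adj ^^ depth v) rt v"
  unfolding depth_def using reach_rt rtranclp_imp_relpowp by (metis LeastI)

lemma depth_le: "(adj ^^ n) rt v \<Longrightarrow> depth v \<le> n"
  unfolding depth_def by (rule Least_le)

lemma depth_rt [simp]: "depth rt = 0"
  using depth_le[of 0 rt] by simp

lemma depth_0: "v \<in> verts T \<Longrightarrow> depth v = 0 \<Longrightarrow> v = rt"
  using depth_relpowp[of v] by simp

lemma depth_adj: "adj u v \<Longrightarrow> depth v \<le> Suc (depth u)"
  using depth_relpowp[of u] adj_verts[of u v] by (intro depth_le) auto

lemma depth_Suc:
  assumes "v \<in> verts T" "depth v = Suc n"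
  obtains u where "adj u v" "depth u = n"
proof -
  obtain u where u: "(adj ^^ n) rt u" "adj u v"
    using depth_relpowp[OF assms(1)] assms(2) by auto
  then have "depth u = n" using depth_le[OF u(1)] depth_adj[OF u(2)] assms(2) by simp
  then show ?thesis using that u by blast
qed

text \<open>All vertices before \<open>x\<close> on a shortest path from the root have depth less
  than that of \<open>x\<close>, so none of them is \<open>v\<close>.\<close>

lemma reach_avoiding:
  assumes "x \<in> verts T" "depth x \<le> depth v" "x \<noteq> v"
  shows "(\<lambda>a b. adj a b \<and> a \<noteq> v \<and> b \<noteq> v)\<^sup>*\<^sup>* rt x"
  using assms
proof (induction "depth x" arbitrary: x)
  case 0
  then show ?case using depth_0 by fastforce
next
  case (Suc n)
  obtain u where u: "adj u x" "depth u = n"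
    using depth_Suc[OF Suc.prems(1) Suc.hyps(2)[symmetric]] by blast
  then have "u \<noteq> v" using Suc.prems(2) Suc.hyps(2) by auto
  moreover have "(\<lambda>a b. adj a b \<and> a \<noteq> v \<and> b \<noteq> v)\<^sup>*\<^sup>* rt u"
    by (rule Suc.hyps(1)) (use u adj_verts[OF u(1)] \<open>u \<noteq> v\<close> Suc.prems(2) Suc.hyps(2) in auto)
  ultimately show ?case using u(1) Suc.prems(3) by (simp add: rtranclp.rtrancl_into_rtrancl)
qed

text \<open>Two such neighbours would be joined through the root without touching \<open>v\<close>,
  which closes a cycle through \<open>v\<close>. Allowing equal depth also rules out a second
  neighbour on the level of \<open>v\<close>, so that all other neighbours lie strictly
  deeper.\<close>

lemma unique_lower_neighbour:
  assumes "adj v x" "adj v y" "depth x \<le> depth v" "depth y \<le> depth v"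
  shows "x = y"
proof (rule ccontr)
  assume "x \<noteq> y"
  let ?R = "\<lambda>a b. adj a b \<and> a \<noteq> v \<and> b \<noteq> v"
  have xy: "x \<in> verts T" "y \<in> verts T" "x \<noteq> v" "y \<noteq> v" using assms(1,2) adj_verts by blast+
  have "symp ?R" by (auto intro: sympI adj_sym)
  then have "symp ?R\<^sup>*\<^sup>*" by (rule symp_rtranclp)
  then have "?R\<^sup>*\<^sup>* x rt" using reach_avoiding[OF xy(1) assms(3) xy(3)] by (rule sympD)
  then have "?R\<^sup>*\<^sup>* x y" using reach_avoiding[OF xy(2) assms(4) xy(4)] by (rule rtranclp_trans)
  then obtain xs where xs: "xs \<noteq> []" "hd xs = x" "last xs = y" "distinct xs" "successively ?R xs"
    using rtranclp_simple_path[of ?R x y] by blast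
  have len: "2 \<le> length xs" 
  proof -
    obtain a ys where "xs = a # ys" using xs(1) by (cases xs) auto
    moreover from this have "ys \<noteq> []" using xs(2,3) \<open>x \<noteq> y\<close> by auto
    ultimately show ?thesis by (cases ys) auto
  qed
  have nth: "adj (xs ! i) (xs ! Suc i) \<and> xs ! i \<noteq> v \<and> xs ! Suc i \<noteq> v" if "Suc i < length xs" for i
    using xs(5) that by (simp add: successively_conv_nth)
  have "v \<notin> set xs"
  proof
    assume "v \<in> set xs"
    then obtain i where i: "i < length xs" "xs ! i = v" by (auto simp: in_set_conv_nth)
    show False
    proof (cases i)
      case 0
      then show False using i nth[of 0] len by simp
    next
      case (Suc j)
      then show False using i nth[of j] by simp
    qed
  qed
  have "is_cycle T (v # xs)"
    unfolding is_cycle_def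
  proof (intro conjI allI impI)
    show "3 \<le> length (v # xs)" using len by simp
    show "distinct (v # xs)" using xs(4) \<open>v \<notin> set xs\<close> by simp
    fix i assume i: "i < length (v # xs)"
    consider "i = 0" | j where "i = Suc j" "Suc j < length xs" | "i = length xs" "i \<noteq> 0"
    proof (cases i)
      case (Suc j)
      then show thesis using that(2)[of j] that(3) i xs(1) by (cases "Suc j = length xs") auto
    qed (use that(1) in auto)
    then show "{(v # xs) ! i, (v # xs) ! (Suc i mod length (v # xs))} \<in> edges T"
    proof cases
      case 1
      then show ?thesis using assms(1) xs(1,2) len by (simp add: adj_def hd_conv_nth)
    next
      case 2
      then show ?thesis using nth[of j] by (simp add: adj_def)
    next
      case 3
      then show ?thesis using adj_sym[OF assms(2)] xs(1,3) by (simp add: adj_def last_conv_nth nth_Cons')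
    qed
  qed
  then show False using tree by (auto simp: regular_tree_def is_tree_def)
qed

lemma neighbours: 
  assumes "v \<in> verts T"
  shows "finite {w. adj v w}" "card {w. adj v w} = 4"
proof -
  have "bij_betw (\<lambda>w. {v, w}) {w. adj v w} {e \<in> edges T. v \<in> e}"
  proof (rule bij_betwI')
    fix e assume e: "e \<in> {e \<in> edges T. v \<in> e}"
    then obtain a b where "a \<noteq> b" "e = {a, b}"
      using tree unfolding regular_tree_def is_tree_def simple_graph_def by blast
    then have "e = {v, b} \<or> e = {v, a}" using e by auto
    then show "\<exists>w\<in>{w. adj v w}. e = {v, w}" using e by (auto simp: adj_def)
  qed (auto simp: adj_def doubleton_eq_iff)
  then show "card {w. adj v w} = 4"
    using assms tree by (simp add: bij_betw_same_card regular_tree_def vdegree_def)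
  then show "finite {w. adj v w}" using card.infinite by fastforce
qed

text \<open>The root has a fourth child, which is left out to make the explored tree uniformly
  ternary.\<close>

lemma children:
  assumes "v \<in> verts T"
  shows "\<exists>f. inj_on f {..<3::nat} \<and> (\<forall>i<3. adj v (f i) \<and> depth (f i) = Suc (depth v))"
proof -
  let ?A = "{w. adj v w}" and ?C = "{w. adj v w \<and> depth w = Suc (depth v)}"
  let ?D = "{w. adj v w \<and> depth w \<le> depth v}"
  have fin: "finite ?A" using neighbours[OF assms] by blast
  have "?A \<subseteq> ?C \<union> ?D" using depth_adj by fastforce
  then have "card ?A \<le> card (?C \<union> ?D)" using fin by (intro card_mono) auto
  also have "\<dots> \<le> card ?C + card ?D" by (rule card_Un_le)
  also have "card ?D \<le> 1" 
  proof -
    have "finite ?D" using fin by simp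
    then show ?thesis using unique_lower_neighbour card_le_Suc0_iff_eq[of ?D] by auto
  qed
  finally have "3 \<le> card ?C" using neighbours[OF assms] by simp
  then obtain f :: "nat \<Rightarrow> 'v" where "inj_on f {..<3}" "f ` {..<3} \<subseteq> ?C"
    using card_le_inj[of "{..<3::nat}" ?C] fin by auto
  then show ?thesis by (intro exI[of _ f]) auto
qed

definition child :: "'v \<Rightarrow> nat \<Rightarrow> 'v" where
  "child v = (SOME f. inj_on f {..<3::nat} \<and> (\<forall>i<3. adj v (f i) \<and> depth (f i) = Suc (depth v)))"

lemma child:
  assumes "v \<in> verts T"
  shows "inj_on (child v) {..<3}" "i < 3 \<Longrightarrow> adj v (child v i)" "i < 3 \<Longrightarrow> depth (child v i) = Suc (depth v)"
  using someI_ex[OF children[OF assms]] unfolding child_def by blast+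

primrec emb :: "nat list \<Rightarrow> 'v" where
  "emb [] = rt"
| "emb (i # w) = child (emb w) i"

lemma emb_verts: "w \<in> lists {..<3} \<Longrightarrow> emb w \<in> verts T"
  by (induction w) (use rt child(2) adj_verts in auto)

lemma depth_emb: "w \<in> lists {..<3} \<Longrightarrow> depth (emb w) = length w"
  by (induction w) (auto simp: child(3) emb_verts)

lemma adj_emb: "i < 3 \<Longrightarrow> w \<in> lists {..<3} \<Longrightarrow> adj (emb w) (emb (i # w))"
  by (simp add: child(2) emb_verts)

text \<open>Depth recovers the length of the word, and the parent is the unique lower
  neighbour.\<close>

lemma emb_inj: "w \<in> lists {..<3} \<Longrightarrow> w' \<in> lists {..<3} \<Longrightarrow> emb w = emb w' \<Longrightarrow> w = w'"
proof (induction w arbitrary: w')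
  case Nil
  then show ?case using depth_emb[of w'] by simp
next
  case (Cons i w)
  have "length w' = Suc (length w)" using depth_emb[of w'] depth_emb[of "i # w"] Cons.prems by simp
  then obtain j v where w': "w' = j # v" "length v = length w" by (cases w') auto
  have *: "i < 3" "j < 3" "w \<in> lists {..<3}" "v \<in> lists {..<3}" using Cons.prems w' by auto
  have "emb w = emb v"
  proof (rule unique_lower_neighbour)
    show "adj (emb (i # w)) (emb w)" using adj_emb[OF *(1,3)] by (rule adj_sym)
    show "adj (emb (i # w)) (emb v)" unfolding Cons.prems(3) w'(1) using adj_emb[OF *(2,4)] by (rule adj_sym)
  qed (use depth_emb[OF Cons.prems(1)] depth_emb[OF *(3)] depth_emb[OF *(4)] w' in auto)
  then have "w = v" using Cons.IH * by blast
  moreover have "i = j"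
    using child(1)[OF emb_verts[OF *(3)]] Cons.prems(3) * w' \<open>w = v\<close> by (auto simp: inj_on_def)
  ultimately show ?case using w' by simp
qed

lemma countable_verts: "countable (verts T)"
proof -
  have "finite {v. (adj ^^ n) rt v}" for n
  proof (induction n)
    case (Suc n)
    have "{v. (adj ^^ Suc n) rt v} \<subseteq> (\<Union>u\<in>{v. (adj ^^ n) rt v} \<inter> verts T. {w. adj u w})"
      using adj_verts by auto
    moreover have "finite \<dots>" using Suc neighbours by auto
    ultimately show ?case by (rule finite_subset)
  qed auto
  then have "countable (\<Union>n. {v. (adj ^^ n) rt v})" by (auto intro: countable_finite)
  moreover have "verts T \<subseteq> (\<Union>n. {v. (adj ^^ n) rt v})" using depth_relpowp by auto
  ultimately show ?thesis by (rule countable_subset[rotated])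
qed

end

section \<open>Transfer of the exploration to the percolation measure\<close>

section \<open>Finite-dimensional events of bond percolation\<close>

lemma prob_space_percolation: "prob_space (percolation G p)"
  unfolding percolation_def by (intro prob_space_PiM measure_pmf.prob_space_axioms)

lemma measurable_percolation_component:
  "e \<in> edges G \<Longrightarrow> (\<lambda>\<omega>. \<omega> e) \<in> percolation G p \<rightarrow>\<^sub>M count_space UNIV"
  unfolding percolation_def
  using measurable_component_singleton[of e "edges G" "\<lambda>_. measure_pmf (bernoulli_pmf p)"]
  by (simp cong: measurable_cong_sets)

lemma prob_cylinder:
  assumes p: "0 \<le> p" "p \<le> 1" and J: "finite J" "J \<subseteq> edges G"
  shows "measure (percolation G p) {\<omega> \<in> space (percolation G p). \<forall>e\<in>J. \<omega> e = (e \<in> S)} =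
    p ^ card (J \<inter> S) * (1 - p) ^ card (J - S)"
proof -
  let ?M = "\<lambda>e :: 'a set. measure_pmf (bernoulli_pmf p)"
  interpret product_prob_space ?M "edges G"
    by unfold_locales
  have "emeasure (percolation G p) {\<omega> \<in> space (percolation G p). \<forall>e\<in>J. \<omega> e \<in> {e \<in> S}} =
      (\<Prod>e\<in>J. emeasure (?M e) {e \<in> S})"
    unfolding percolation_def by (rule emeasure_PiM_Collect) (use J in auto)
  also have "\<dots> = ennreal (\<Prod>e\<in>J. measure (?M e) {e \<in> S})"
    by (simp add: prod_ennreal measure_pmf.emeasure_eq_measure)
  also have "(\<Prod>e\<in>J. measure (?M e) {e \<in> S}) = (\<Prod>e\<in>J. if e \<in> S then p else 1 - p)"
    using p by (intro prod.cong) (auto simp: measure_pmf_single)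
  also have "\<dots> = p ^ card (J \<inter> S) * (1 - p) ^ card (J - S)"
    using J(1) by (simp add: prod.If_cases Diff_eq Collect_neg_eq)
  finally show ?thesis using p by (simp add: measure_def)
qed

lemma prob_all_open:
  assumes "0 \<le> p" "p \<le> 1" "finite J" "J \<subseteq> edges G"
  shows "measure (percolation G p) {\<omega> \<in> space (percolation G p). \<forall>e\<in>J. \<omega> e} = p ^ card J"
proof -
  have "{\<omega> \<in> space (percolation G p). \<forall>e\<in>J. \<omega> e} =
      {\<omega> \<in> space (percolation G p). \<forall>e\<in>J. \<omega> e = (e \<in> J)}" by auto
  then show ?thesis using prob_cylinder[OF assms, of J] by simp
qed

lemma sets_cylinder:
  assumes "finite J" "J \<subseteq> edges G"
  shows "{\<omega> \<in> space (percolation G p). \<forall>e\<in>J. \<omega> e = f e} \<in> sets (percolation G p)"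
  using assms by (intro sets.sets_Collect_finite_All measurable_sets_Collect[OF measurable_percolation_component]) auto

text \<open>The bridge from finite sums to the product measure: an injection \<open>g\<close> of
  labels into edges turns the open edges in its range into a Bernoulli subset of
  \<open>F\<close>.\<close>

lemma prob_bexp:
  fixes g :: "'l \<Rightarrow> 'v set" and Q :: "'l set \<Rightarrow> bool"
  assumes p: "0 \<le> p" "p \<le> 1" and F: "finite F" "inj_on g F" "g ` F \<subseteq> edges G"
  shows "{\<omega> \<in> space (percolation G p). Q {l \<in> F. \<omega> (g l)}} \<in> sets (percolation G p)"
    and "measure (percolation G p) {\<omega> \<in> space (percolation G p). Q {l \<in> F. \<omega> (g l)}} =
      bexp p F (\<lambda>S. of_bool (Q S))"
proof -
  interpret prob_space "percolation G p" by (rule prob_space_percolation)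
  define A where "A S = {\<omega> \<in> space (percolation G p). \<forall>e\<in>g ` F. \<omega> e = (e \<in> g ` S)}" for S
  have mem: "g l \<in> g ` S \<longleftrightarrow> l \<in> S" if "l \<in> F" "S \<subseteq> F" for l S
    using F(2) that by (meson inj_on_image_mem_iff)
  have A_iff: "\<omega> \<in> A S \<longleftrightarrow> \<omega> \<in> space (percolation G p) \<and> {l \<in> F. \<omega> (g l)} = S" if "S \<subseteq> F" for \<omega> S
    using that mem unfolding A_def by auto
  have A_sets: "A S \<in> sets (percolation G p)" for S
    unfolding A_def by (rule sets_cylinder) (use F in auto)
  have PA: "measure (percolation G p) (A S) = p ^ card S * (1 - p) ^ card (F - S)" if "S \<subseteq> F" for S
  proof -
    have "g ` F \<inter> g ` S = g ` S" "g ` F - g ` S = g ` (F - S)"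
      using that F(2) by (auto simp: inj_on_image_set_diff)
    moreover have "card (g ` S) = card S" "card (g ` (F - S)) = card (F - S)"
      using that F(2) by (auto intro!: card_image intro: inj_on_subset)
    ultimately show ?thesis
      unfolding A_def using F by (subst prob_cylinder[OF p]) auto
  qed
  have un: "{\<omega> \<in> space (percolation G p). Q {l \<in> F. \<omega> (g l)}} = (\<Union>S\<in>{S \<in> Pow F. Q S}. A S)"
    using A_iff by auto
  show "{\<omega> \<in> space (percolation G p). Q {l \<in> F. \<omega> (g l)}} \<in> sets (percolation G p)"
    unfolding un using F(1) A_sets by (intro sets.finite_UN) auto
  have "measure (percolation G p) (\<Union>S\<in>{S \<in> Pow F. Q S}. A S) = (\<Sum>S\<in>{S \<in> Pow F. Q S}. measure (percolation G p) (A S))"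
    using F(1) A_sets A_iff by (intro finite_measure_finite_Union) (auto simp: disjoint_family_on_def)
  also have "\<dots> = (\<Sum>S\<in>{S \<in> Pow F. Q S}. p ^ card S * (1 - p) ^ card (F - S))"
    by (intro sum.cong) (auto simp: PA)
  also have "\<dots> = bexp p F (\<lambda>S. of_bool (Q S))"
    unfolding bexp_def using F(1) by (intro sum.mono_neutral_cong_left) auto
  finally show "measure (percolation G p) {\<omega> \<in> space (percolation G p). Q {l \<in> F. \<omega> (g l)}} =
      bexp p F (\<lambda>S. of_bool (Q S))" unfolding un .
qed

section \<open>Exploring the product graph\<close>

context rooted_tree
begin

abbreviation TZ :: "('v \<times> int) sgraph" where "TZ \<equiv> T \<box> int_line"

definition open_adj :: "(('v \<times> int) set \<Rightarrow> bool) \<Rightarrow> 'v \<times> int \<Rightarrow> 'v \<times> int \<Rightarrow> bool" where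
  "open_adj \<omega> x y \<longleftrightarrow> {x, y} \<in> edges TZ \<and> \<omega> {x, y}"

lemma edges_TZ_iff:
  "{(u, k), (v, l)} \<in> edges TZ \<longleftrightarrow>
    (u = v \<and> u \<in> verts T \<and> (l = k + 1 \<or> k = l + 1)) \<or> (adj u v \<and> k = l)"
proof
  assume "{(u, k), (v, l)} \<in> edges TZ"
  then obtain u' k' v' l' where "{(u, k), (v, l)} = {(u', k'), (v', l')}" "u' \<in> verts T" "v' \<in> verts T"
    "u' = v' \<and> {k', l'} \<in> edges int_line \<or> {u', v'} \<in> edges T \<and> k' = l'"
    by (auto simp: cart_prod_def)
  then show "(u = v \<and> u \<in> verts T \<and> (l = k + 1 \<or> k = l + 1)) \<or> (adj u v \<and> k = l)"
    by (auto simp: adj_def int_line_def doubleton_eq_iff insert_commute)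
next
  assume "(u = v \<and> u \<in> verts T \<and> (l = k + 1 \<or> k = l + 1)) \<or> (adj u v \<and> k = l)"
  then have "u \<in> verts T" "v \<in> verts T" "u = v \<and> {k, l} \<in> edges int_line \<or> {u, v} \<in> edges T \<and> k = l"
    using adj_verts by (auto simp: adj_def int_line_def doubleton_eq_iff)
  moreover from this have "(u, k) \<in> verts T \<times> verts int_line \<and> (v, l) \<in> verts T \<times> verts int_line"
    by (simp add: int_line_def)
  ultimately show "{(u, k), (v, l)} \<in> edges TZ"
    unfolding cart_prod_def sgraph.select_convs by blast
qed

lemma verts_TZ: "verts TZ = verts T \<times> UNIV"
  by (simp add: cart_prod_def int_line_def)

lemma open_adj_sym: "open_adj \<omega> x y \<Longrightarrow> open_adj \<omega> y x"
  by (simp add: open_adj_def insert_commute)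

lemma open_adj_rtranclp_sym: "(open_adj \<omega>)\<^sup>*\<^sup>* x y \<Longrightarrow> (open_adj \<omega>)\<^sup>*\<^sup>* y x"
  using symp_rtranclp[of "open_adj \<omega>"] open_adj_sym by (metis sympD sympI)

lemma open_adj_verts: "open_adj \<omega> x y \<Longrightarrow> x \<in> verts TZ \<and> y \<in> verts TZ"
  by (cases x; cases y) (auto simp: open_adj_def edges_TZ_iff verts_TZ dest: adj_verts)

lemma open_reach_verts: "(open_adj \<omega>)\<^sup>*\<^sup>* x y \<Longrightarrow> x \<in> verts TZ \<Longrightarrow> y \<in> verts TZ"
  by (induction rule: rtranclp_induct) (auto dest: open_adj_verts)

lemma clusters_TZ: "clusters TZ \<omega> = {{y. (open_adj \<omega>)\<^sup>*\<^sup>* x y} | x. x \<in> verts TZ}"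
proof -
  have "reachable (open_subgraph TZ \<omega>) = (open_adj \<omega>)\<^sup>*\<^sup>*"
    by (auto simp: reachable_def open_subgraph_def open_adj_def[abs_def])
  moreover have "{y \<in> verts TZ. (open_adj \<omega>)\<^sup>*\<^sup>* x y} = {y. (open_adj \<omega>)\<^sup>*\<^sup>* x y}" if "x \<in> verts TZ" for x
    using open_reach_verts[OF _ that] by blast
  ultimately show ?thesis
    unfolding clusters_def graph_components_def open_subgraph_def by (auto; metis)
qed

text \<open>\<open>tl w\<close> is the word of the parent, which is why \<open>word_labels\<close>
  admits nonempty words only; the column of the root is never scanned.\<close>

definition label_edge :: "nat list \<times> bool \<times> int \<Rightarrow> ('v \<times> int) set" where
  "label_edge = (\<lambda>(w, b, k).
    (if b then {(emb (tl w), k), (emb w, k)} else {(emb w, k), (emb w, k + 1)}))"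

definition word_labels :: "(nat list \<times> bool \<times> int) set" where
  "word_labels = {w \<in> lists {..<3}. w \<noteq> []} \<times> UNIV"

lemma label_edge_edges: "l \<in> word_labels \<Longrightarrow> label_edge l \<in> edges TZ"
proof -
  assume "l \<in> word_labels"
  then obtain i w b k where l: "l = (i # w, b, k)" "i < 3" "w \<in> lists {..<3}"
    unfolding word_labels_def by (cases l; cases "fst l") auto
  then show ?thesis using adj_emb[OF l(2,3)] emb_verts[of "i # w"] by (auto simp: label_edge_def edges_TZ_iff)
qed

lemma inj_on_label_edge: "inj_on label_edge word_labels"
proof (rule inj_onI)
  fix l l' assume *: "l \<in> word_labels" "l' \<in> word_labels" "label_edge l = label_edge l'"
  obtain i w b k where l: "l = (i # w, b, k)" "i # w \<in> lists {..<3}" "w \<in> lists {..<3}"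
    using *(1) unfolding word_labels_def by (cases l; cases "fst l") auto
  obtain j v c m where l': "l' = (j # v, c, m)" "j # v \<in> lists {..<3}" "v \<in> lists {..<3}"
    using *(2) unfolding word_labels_def by (cases l'; cases "fst l'") auto
  have ne: "emb w \<noteq> emb (i # w)" "emb v \<noteq> emb (j # v)"
    using emb_inj[OF l(3,2)] emb_inj[OF l'(3,2)] by (metis not_Cons_self2)+
  \<comment> \<open>An edge between parent and child cannot be read in both directions, by the
    lengths of the words.\<close>
  have cross: "\<not> (emb w = emb (j # v) \<and> emb (i # w) = emb v)"
    using emb_inj[OF l(3) l'(2)] emb_inj[OF l(2) l'(3)] by (metis length_Cons n_not_Suc_n Suc_n_not_n less_irrefl lessI less_trans)
  have same: "emb (i # w) = emb (j # v) \<Longrightarrow> i # w = j # v" using emb_inj[OF l(2) l'(2)] .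
  note e = *(3)[unfolded l(1) l'(1) label_edge_def prod.case list.sel]
  show "l = l'"
  proof (cases b; cases c)
    assume "b" "c" with e have "{(emb w, k), (emb (i # w), k)} = {(emb v, m), (emb (j # v), m)}" by simp
    then show ?thesis using cross same \<open>b\<close> \<open>c\<close> unfolding l(1) l'(1) doubleton_eq_iff by auto
  next
    assume "\<not> b" "\<not> c" with e have "{(emb (i # w), k), (emb (i # w), k + 1)} = {(emb (j # v), m), (emb (j # v), m + 1)}" by simp
    then show ?thesis using same \<open>\<not> b\<close> \<open>\<not> c\<close> unfolding l(1) l'(1) doubleton_eq_iff by auto
  next
    assume "b" "\<not> c" with e have "{(emb w, k), (emb (i # w), k)} = {(emb (j # v), m), (emb (j # v), m + 1)}" by simp
    then show ?thesis unfolding doubleton_eq_iff by auto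
  next
    assume "\<not> b" "c" with e have "{(emb (i # w), k), (emb (i # w), k + 1)} = {(emb v, m), (emb (j # v), m)}" by simp
    then show ?thesis unfolding doubleton_eq_iff by auto
  qed
qed


text \<open>The induction also carries that each site of \<open>K\<close> is joined to the current
  site, so that a later hit connects the whole run to \<open>x\<close>.\<close>

lemma scan_open:
  assumes w: "i # v \<in> lists {..<3}" "w = i # v"
    and S: "S = {l \<in> word_labels. \<omega> (label_edge l)}"
    and B: "\<And>k. k \<in> B \<Longrightarrow> (open_adj \<omega>)\<^sup>*\<^sup>* x (emb v, k)"
    and st: "scan w B L n S = (C, K, b)"
  shows "\<forall>k\<in>C. (open_adj \<omega>)\<^sup>*\<^sup>* x (emb w, k)"
proof -
  have link: "open_adj \<omega> (emb v, k) (emb w, k)" if "(w, True, k) \<in> S" for k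
    using that w adj_emb[of i v] by (auto simp: S open_adj_def label_edge_def edges_TZ_iff)
  have col: "open_adj \<omega> (emb w, k) (emb w, k + 1)" if "(w, False, k) \<in> S" for k
    using that w emb_verts[of w] by (auto simp: S open_adj_def label_edge_def edges_TZ_iff)
  have "(\<forall>k\<in>C. (open_adj \<omega>)\<^sup>*\<^sup>* x (emb w, k)) \<and>
      (\<forall>k\<in>K. (open_adj \<omega>)\<^sup>*\<^sup>* (emb w, L + int n) (emb w, k)) \<and>
      (b \<longrightarrow> (open_adj \<omega>)\<^sup>*\<^sup>* x (emb w, L + int n))"
    using st
  proof (induction n arbitrary: C K b)
    case (Suc n)
    obtain C' K' b' where st': "scan w B L n S = (C', K', b')" by (cases "scan w B L n S")
    note IH = Suc.IH[OF st']
    define k where "k = L + int (Suc n)"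
    have k: "L + int n + 1 = k" by (simp add: k_def)
    have hit: "(open_adj \<omega>)\<^sup>*\<^sup>* x (emb w, k)" if "k \<in> B \<and> (w, True, k) \<in> S"
      using B[of k] link[of k] that by (meson rtranclp.rtrancl_into_rtrancl)
    have up: "open_adj \<omega> (emb w, L + int n) (emb w, k)" if "(w, False, L + int n) \<in> S"
      using col[OF that] k by simp
    have down: "(open_adj \<omega>)\<^sup>*\<^sup>* (emb w, k) (emb w, j)" if "(w, False, L + int n) \<in> S" "j \<in> K'" for j
      using open_adj_sym[OF up[OF that(1)]] IH that(2) by (meson converse_rtranclp_into_rtranclp)
    have upr: "(open_adj \<omega>)\<^sup>*\<^sup>* x (emb w, k)" if "(w, False, L + int n) \<in> S" b'
      using up[OF that(1)] IH that(2) by (meson rtranclp.rtrancl_into_rtrancl)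
    have downr: "(open_adj \<omega>)\<^sup>*\<^sup>* x (emb w, j)" if "(w, False, L + int n) \<in> S" "j \<in> K'" "k \<in> B \<and> (w, True, k) \<in> S" for j
      using down[OF that(1,2)] hit[OF that(3)] by (meson rtranclp_trans)
    show ?case
      using Suc.prems IH hit upr down downr unfolding scan.simps st' scan_step.simps k_def[symmetric]
      by (auto split: if_splits)
  qed auto
  then show ?thesis by blast
qed

lemma survive_open:
  assumes "v \<in> lists {..<3}" "survive n r v B {l \<in> word_labels. \<omega> (label_edge l)}"
    and "\<And>k. k \<in> B \<Longrightarrow> (open_adj \<omega>)\<^sup>*\<^sup>* x (emb v, k)"
  shows "\<exists>y. (open_adj \<omega>)\<^sup>*\<^sup>* x y \<and> depth (fst y) = length v + n"
  using assms
proof (induction n arbitrary: r v B)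
  case 0
  then obtain k where "k \<in> B" by auto
  then show ?case using 0 depth_emb[of v] by (intro exI[of _ "(emb v, k)"]) auto
next
  case (Suc n)
  let ?S = "{l \<in> word_labels. \<omega> (label_edge l)}"
  obtain i where i: "i < 3" "survive n (r + 6) (i # v) (next_level r (i # v) B ?S) ?S"
    using Suc.prems(2) by auto
  have iv: "i # v \<in> lists {..<3}" using i Suc.prems(1) by auto
  obtain C K b where st: "scan (i # v) B (- int r - 6) (2 * r + 12) ?S = (C, K, b)"
    by (cases "scan (i # v) B (- int r - 6) (2 * r + 12) ?S")
  have "(open_adj \<omega>)\<^sup>*\<^sup>* x (emb (i # v), k)" if "k \<in> next_level r (i # v) B ?S" for k
    using scan_open[OF iv refl refl Suc.prems(3) st] that unfolding next_level_def st by auto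
  from Suc.IH[OF iv i(2) this] show ?case by simp
qed

text \<open>A finite cluster has bounded depth. Asking for infinitely many \<open>n\<close> avoids
  comparing the survival events of different levels.\<close>

lemma survive_imp_infinite_cluster:
  assumes "w \<in> lists {..<3}" "\<exists>\<^sub>\<infinity>n. survive n 0 w {0} {l \<in> word_labels. \<omega> (label_edge l)}"
  shows "\<exists>C\<in>clusters TZ \<omega>. infinite C"
proof -
  let ?C = "{y. (open_adj \<omega>)\<^sup>*\<^sup>* (emb w, 0) y}"
  have "infinite ?C"
  proof
    assume "finite ?C"
    then obtain m where m: "\<And>y. y \<in> ?C \<Longrightarrow> depth (fst y) < m"
      using finite_imageI[of ?C "depth \<circ> fst"] by (metis finite_nat_set_iff_bounded imageI comp_apply)
    obtain n where n: "m \<le> n" "survive n 0 w {0} {l \<in> word_labels. \<omega> (label_edge l)}"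
      using assms(2) unfolding INFM_nat_le by blast
    obtain y where "(open_adj \<omega>)\<^sup>*\<^sup>* (emb w, 0) y" "depth (fst y) = length w + n"
      using survive_open[OF assms(1) n(2), of "(emb w, 0)"] by auto
    then show False using m[of y] n(1) by simp
  qed
  moreover have "?C \<in> clusters TZ \<omega>"
    unfolding clusters_TZ using emb_verts[OF assms(1)] by (auto simp: verts_TZ)
  ultimately show ?thesis by blast
qed

end

section \<open>The critical probability\<close>

context rooted_tree
begin

text \<open>Read from the back: \<open>i\<close> steps along the ray of children 0, then a turn to
  child 1. The subtrees hanging there are pairwise disjoint, since the trailing zeros determine
  \<open>i\<close>.\<close>

definition spur :: "nat \<Rightarrow> nat list" where "spur i = 1 # replicate i 0"

lemma spur_words: "spur i \<in> lists {..<3}"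
  by (auto simp: spur_def)

lemma spur_inj:
  assumes "x @ spur i = y @ spur j"
  shows "i = j"
proof -
  have *: "takeWhile (\<lambda>z. z = 0) (rev (x @ spur i)) = replicate i 0" for x i
    by (simp add: spur_def takeWhile_append2 takeWhile_append)
  have "replicate i (0::nat) = replicate j 0" using *[of x i] *[of y j] assms by simp
  then show ?thesis using length_replicate by metis
qed

lemma survive_labels_word_labels:
  "w \<in> lists {..<3} \<Longrightarrow> survive_labels n r w \<subseteq> word_labels"
proof (induction n arbitrary: r w)
  case (Suc n)
  have "level_labels r (i # w) \<union> survive_labels n (r + 6) (i # w) \<subseteq> word_labels" if "i < 3" for i
    using Suc.IH[of "i # w" "r + 6"] level_labels_fst[of _ r "i # w"] that Suc.prems
    by (force simp: word_labels_def)
  then show ?case by auto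
qed simp

lemma no_survival:
  fixes n m :: nat
  defines "P \<equiv> percolation TZ (2249/10000)"
  defines "G \<equiv> {\<omega> \<in> space P. \<forall>i<m. \<not> survive n 0 (spur i) {0} {l \<in> word_labels. \<omega> (label_edge l)}}"
  shows "G \<in> sets P" and "measure P G \<le> (999/1000) ^ m"
proof -
  let ?p = "2249/10000 :: real"
  define F where "F i = survive_labels n 0 (spur i)" for i
  define Q where "Q S \<longleftrightarrow> (\<forall>i<m. \<not> survive n 0 (spur i) {0} S)" for S
  have F: "(\<Union>i\<in>{..<m}. F i) \<subseteq> word_labels"
    using survive_labels_word_labels[OF spur_words] by (auto simp: F_def)
  have fin: "finite (\<Union>i\<in>{..<m}. F i)" by (simp add: F_def)
  have QF: "Q {l \<in> (\<Union>i\<in>{..<m}. F i). \<omega> (label_edge l)} = Q {l \<in> word_labels. \<omega> (label_edge l)}" for \<omega>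
  proof -
    have "{l \<in> (\<Union>i\<in>{..<m}. F i). \<omega> (label_edge l)} = {l \<in> word_labels. \<omega> (label_edge l)} \<inter> (\<Union>i\<in>{..<m}. F i)"
      using F by auto
    moreover have "survive n 0 (spur i) {0} (S \<inter> (\<Union>i\<in>{..<m}. F i)) = survive n 0 (spur i) {0} S"
      if "i < m" for i S
      by (rule survive_inter) (use that in \<open>auto simp: F_def\<close>)
    ultimately show ?thesis unfolding Q_def by simp
  qed
  have G: "G = {\<omega> \<in> space P. Q {l \<in> (\<Union>i\<in>{..<m}. F i). \<omega> (label_edge l)}}"
    unfolding QF unfolding G_def Q_def ..
  have prob: "0 \<le> ?p" "?p \<le> 1" by simp_all
  have inj: "inj_on label_edge (\<Union>i\<in>{..<m}. F i)" using inj_on_label_edge F by (rule inj_on_subset)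
  have img: "label_edge ` (\<Union>i\<in>{..<m}. F i) \<subseteq> edges TZ" using F label_edge_edges by blast
  note E = prob_bexp[OF prob fin inj img, of Q, folded P_def, folded G]
  show "G \<in> sets P" by (rule E(1))
  have ob: "of_bool (Q S) = (\<Prod>i\<in>{..<m}. 1 - of_bool (survive n 0 (spur i) {0} S) :: real)" for S
    unfolding Q_def by (cases "\<exists>i<m. survive n 0 (spur i) {0} S") (auto simp: prod_zero_iff)
  have "measure P G = bexp ?p (\<Union>i\<in>{..<m}. F i) (\<lambda>S. \<Prod>i\<in>{..<m}. 1 - of_bool (survive n 0 (spur i) {0} S))"
    unfolding E(2) ob ..
  also have "\<dots> = (\<Prod>i\<in>{..<m}. bexp ?p (F i) (\<lambda>S. 1 - of_bool (survive n 0 (spur i) {0} S)))"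
  proof (rule bexp_prod)
    fix i j :: nat assume "i \<noteq> j"
    show "F i \<inter> F j = {}"
    proof (rule ccontr)
      assume "F i \<inter> F j \<noteq> {}"
      then obtain l where "l \<in> F i" "l \<in> F j" by auto
      then obtain x y where "fst l = x @ spur i" "fst l = y @ spur j"
        unfolding F_def using survive_labels_fst by metis
      then show False using spur_inj \<open>i \<noteq> j\<close> by metis
    qed
  next
    fix i S
    have "survive n 0 (spur i) {0} (S \<inter> F i) = survive n 0 (spur i) {0} S"
      by (rule survive_inter) (simp add: F_def)
    then show "1 - of_bool (survive n 0 (spur i) {0} S) = (1 - of_bool (survive n 0 (spur i) {0} (S \<inter> F i)) :: real)"
      by simp
  qed (auto simp: F_def)
  also have "\<dots> = (\<Prod>i\<in>{..<m}. 1 - bexp ?p (F i) (\<lambda>S. of_bool (survive n 0 (spur i) {0} S)))"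
    by (simp add: bexp_diff bexp_const F_def)
  \<comment> \<open>A single start site survives with probability at least 0.01 * (1 - 0.9) =
    1/1000, for every \<open>n\<close>.\<close>
  also have "\<dots> \<le> (\<Prod>i\<in>{..<m}. 999/1000)"
  proof (rule prod_mono)
    fix i :: nat
    have "bexp ?p (F i) (\<lambda>S. of_bool (survive n 0 (spur i) {0} S)) \<le> bexp ?p (F i) (\<lambda>S. 1)"
      by (rule bexp_mono) auto
    also have "\<dots> = 1" by (simp add: bexp_const F_def)
    finally show "0 \<le> 1 - bexp ?p (F i) (\<lambda>S. of_bool (survive n 0 (spur i) {0} S)) \<and>
        1 - bexp ?p (F i) (\<lambda>S. of_bool (survive n 0 (spur i) {0} S)) \<le> 999/1000"
      using survive_probability[of "{0}" 0 n "spur i"] by (simp add: F_def)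
  qed
  also have "\<dots> = (999/1000) ^ m" by simp
  finally show "measure P G \<le> (999/1000) ^ m" .
qed

text \<open>Without an infinite cluster, for each \<open>m\<close> the first \<open>m\<close> spurs
  all fail at every large level. The events \<open>H m N\<close> increase in \<open>N\<close> and
  obey a bound uniform in \<open>N\<close>, so their union obeys it too, and \<open>Z\<close> is a
  measurable null set covering the exceptional configurations.\<close>

lemma AE_infinite_cluster:
  "AE \<omega> in percolation TZ (2249/10000). \<exists>C\<in>clusters TZ \<omega>. infinite C"
proof -
  let ?P = "percolation TZ (2249/10000)"
  interpret prob_space ?P by (rule prob_space_percolation)
  define G where "G m n = {\<omega> \<in> space ?P. \<forall>i<m. \<not> survive n 0 (spur i) {0} {l \<in> word_labels. \<omega> (label_edge l)}}" for m n
  note G = no_survival[folded G_def]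
  define H where "H m N = (\<Inter>n\<in>{N..}. G m n)" for m N
  define Z where "Z = (\<Inter>m. \<Union>N. H m N)"
  have H: "H m N \<in> sets ?P" for m N unfolding H_def using G(1) by (intro sets.countable_INT') auto
  have Z: "Z \<in> sets ?P" unfolding Z_def using H by auto
  have "prob (\<Union>N. H m N) \<le> (999/1000) ^ m" for m
  proof -
    have "incseq (H m)" by (rule incseq_SucI) (auto simp: H_def)
    then have "(\<lambda>N. prob (H m N)) \<longlonglongrightarrow> prob (\<Union>N. H m N)"
      using H by (intro finite_Lim_measure_incseq) auto
    moreover have "prob (H m N) \<le> (999/1000) ^ m" for N
    proof -
      have "prob (H m N) \<le> prob (G m N)" by (rule finite_measure_mono) (auto simp: H_def G(1))
      then show ?thesis using G(2)[of m N] by linarith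
    qed
    ultimately show ?thesis by (intro LIMSEQ_le_const2) auto
  qed
  moreover have "prob Z \<le> prob (\<Union>N. H m N)" for m
    using H by (intro finite_measure_mono) (auto simp: Z_def)
  ultimately have "prob Z \<le> (999/1000) ^ m" for m by (meson order_trans)
  moreover have "(\<lambda>m. (999/1000::real) ^ m) \<longlonglongrightarrow> 0" by (rule LIMSEQ_realpow_zero) auto
  ultimately have "prob Z \<le> 0" by (intro LIMSEQ_le_const) auto
  then have "prob Z = 0" by (simp add: measure_le_0_iff)
  then have "Z \<in> null_sets ?P" using Z by (simp add: null_sets_def emeasure_eq_measure)
  moreover have "{\<omega> \<in> space ?P. \<not> (\<exists>C\<in>clusters TZ \<omega>. infinite C)} \<subseteq> Z"
  proof
    fix \<omega> assume \<omega>: "\<omega> \<in> {\<omega> \<in> space ?P. \<not> (\<exists>C\<in>clusters TZ \<omega>. infinite C)}"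
    let ?s = "\<lambda>n i. survive n 0 (spur i) {0} {l \<in> word_labels. \<omega> (label_edge l)}"
    have "\<not> (\<exists>\<^sub>\<infinity>n. ?s n i)" for i
      using survive_imp_infinite_cluster[OF spur_words[of i], of \<omega>] \<omega> by blast
    then have "\<forall>\<^sub>\<infinity>n. \<not> ?s n i" for i by (simp only: not_INFM not_False_eq_True)
    then have fin: "\<forall>\<^sub>\<infinity>n. \<forall>i\<in>{..<m}. \<not> ?s n i" for m
      unfolding cofinite_eq_sequentially by (intro eventually_ball_finite) auto
    have "\<exists>N. \<omega> \<in> H m N" for m
    proof -
      obtain N where "\<forall>n\<ge>N. \<forall>i<m. \<not> ?s n i" using fin[of m] unfolding MOST_nat_le lessThan_iff Ball_def by blast
      then have "\<omega> \<in> H m N" using \<omega> unfolding H_def G_def by blast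
      then show ?thesis ..
    qed
    then show "\<omega> \<in> Z" unfolding Z_def by blast
  qed
  ultimately show ?thesis by (rule AE_I')
qed

lemma p_c_bound: "p_c TZ < 0.225"
proof -
  have "p_c TZ \<le> 2249/10000"
    unfolding p_c_def by (rule cInf_lower) (use AE_infinite_cluster in \<open>auto intro: bdd_belowI[of _ 0]\<close>)
  then show ?thesis by simp
qed

end

section \<open>Lower bound for the uniqueness threshold\<close>

section \<open>Non-backtracking walks\<close>

fun path_edges :: "'a list \<Rightarrow> 'a set set" where
  "path_edges (x # y # zs) = insert {x, y} (path_edges (y # zs))"
| "path_edges _ = {}"

lemma finite_path_edges [simp]: "finite (path_edges xs)"
  by (induction xs rule: path_edges.induct) auto

lemma path_edges_subset: "e \<in> path_edges xs \<Longrightarrow> e \<subseteq> set xs"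
  by (induction xs rule: path_edges.induct) auto

lemma card_path_edges: "distinct xs \<Longrightarrow> card (path_edges xs) = length xs - 1"
proof (induction xs rule: path_edges.induct)
  case (1 x y zs)
  have "{x, y} \<notin> path_edges (y # zs)" using path_edges_subset[of "{x, y}" "y # zs"] 1 by auto
  then show ?case using 1 by simp
qed auto

lemma path_edges_iff_successively:
  "(\<forall>e\<in>path_edges xs. P e) \<longleftrightarrow> successively (\<lambda>x y. P {x, y}) xs"
  by (induction xs rule: path_edges.induct) auto

definition inv_sqrt3 :: real where "inv_sqrt3 = 1 / sqrt 3"

lemma inv_sqrt3: "0 < inv_sqrt3" "inv_sqrt3 * inv_sqrt3 = 1/3" "1/3 < inv_sqrt3" "inv_sqrt3 < 57736/100000"
proof -
  show *: "0 < inv_sqrt3" "inv_sqrt3 * inv_sqrt3 = 1/3"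
    unfolding inv_sqrt3_def by auto
  show "1/3 < inv_sqrt3"
  proof (rule ccontr)
    assume "\<not> 1/3 < inv_sqrt3"
    then have "inv_sqrt3 * inv_sqrt3 \<le> 1/3 * (1/3)" using * by (intro mult_mono) auto
    then show False using * by simp
  qed
  show "inv_sqrt3 < 57736/100000"
  proof (rule ccontr)
    assume "\<not> inv_sqrt3 < 57736/100000"
    then have "57736/100000 * (57736/100000) \<le> inv_sqrt3 * inv_sqrt3" by (intro mult_mono) auto
    then show False using * by simp
  qed
qed

context rooted_tree
begin

definition nbr :: "'v \<times> int \<Rightarrow> ('v \<times> int) set" where
  "nbr x = {y. {x, y} \<in> edges TZ}"

definition wgt :: "'v \<times> int \<Rightarrow> real" where
  "wgt x = inv_sqrt3 ^ depth (fst x)"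

lemma wgt_pos: "0 < wgt x"
  using inv_sqrt3(1) by (simp add: wgt_def)

lemma nbr_sym: "y \<in> nbr x \<Longrightarrow> x \<in> nbr y"
  by (simp add: nbr_def insert_commute)

lemma nbr_eq:
  assumes "v \<in> verts T"
  shows "nbr (v, k) = {(v, k - 1), (v, k + 1)} \<union> (\<lambda>w. (w, k)) ` {w. adj v w}"
  using assms by (auto simp: nbr_def edges_TZ_iff)

lemma nbr_verts: "y \<in> nbr x \<Longrightarrow> x \<in> verts TZ \<and> y \<in> verts TZ"
  by (cases x; cases y) (auto simp: nbr_def edges_TZ_iff verts_TZ dest: adj_verts)

lemma sum_nbr:
  assumes "v \<in> verts T"
  shows "(\<Sum>y\<in>nbr (v, k). f y) = f (v, k - 1) + f (v, k + 1) + (\<Sum>w\<in>{w. adj v w}. f (w, k))"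
proof -
  have fin: "finite {w. adj v w}" using neighbours[OF assms] by blast
  have "(\<lambda>w. (w, k)) ` {w. adj v w} \<inter> {(v, k - 1), (v, k + 1)} = {}" by auto
  then have "(\<Sum>y\<in>nbr (v, k). f y) =
      (\<Sum>y\<in>{(v, k - 1), (v, k + 1)}. f y) + (\<Sum>y\<in>(\<lambda>w. (w, k)) ` {w. adj v w}. f y)"
    unfolding nbr_eq[OF assms] using fin by (intro sum.union_disjoint) auto
  also have "(\<Sum>y\<in>(\<lambda>w. (w, k)) ` {w. adj v w}. f y) = (\<Sum>w\<in>{w. adj v w}. f (w, k))"
    by (subst sum.reindex) (auto simp: inj_on_def)
  finally show ?thesis by simp
qed

lemma finite_nbr: "finite (nbr x)"
proof (cases "x \<in> verts TZ")
  case True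
  then show ?thesis using neighbours[of "fst x"] by (cases x) (auto simp: nbr_eq verts_TZ)
next
  case False
  then have "nbr x = {}" using nbr_verts by blast
  then show ?thesis by simp
qed

lemma card_nbr: "x \<in> verts TZ \<Longrightarrow> card (nbr x) = 6"
  using sum_nbr[of "fst x" "\<lambda>_. 1::nat" "snd x"] neighbours[of "fst x"] by (cases x) (auto simp: verts_TZ)

lemma wgt_nbr:
  assumes "y \<in> nbr x"
  shows "wgt y \<le> 3 * inv_sqrt3 * wgt x"
proof -
  obtain v k w l where xy: "x = (v, k)" "y = (w, l)" by (cases x; cases y)
  have le: "depth v \<le> Suc (depth w)"
    using assms depth_adj[of w v] adj_sym[of v w] by (auto simp: xy nbr_def edges_TZ_iff)
  have "inv_sqrt3 ^ depth w = 3 * inv_sqrt3 * inv_sqrt3 ^ Suc (depth w)"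
    using inv_sqrt3(2) by (simp add: algebra_simps)
  also have "\<dots> \<le> 3 * inv_sqrt3 * inv_sqrt3 ^ depth v"
    using le inv_sqrt3 by (intro mult_left_mono power_decreasing) auto
  finally show ?thesis by (simp add: wgt_def xy)
qed

text \<open>Relative to \<open>x\<close>, a lower neighbour contributes at most sqrt 3, three
  children together sqrt 3 and the two vertical neighbours 2. At the root four children contribute 4
  / sqrt 3, which is less than 2 * sqrt 3.\<close>

lemma sum_wgt_nbr:
  assumes "x \<in> verts TZ"
  shows "(\<Sum>y\<in>nbr x. wgt y) \<le> (6 * inv_sqrt3 + 2) * wgt x"
proof -
  let ?c = inv_sqrt3
  obtain v k where x: "x = (v, k)" "v \<in> verts T" using assms by (cases x) (auto simp: verts_TZ)
  let ?A = "{w. adj v w}"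
  have fin: "finite ?A" "card ?A = 4" using neighbours[OF x(2)] by auto
  have up: "depth w = Suc (depth v)" if "adj v w" "\<not> depth w \<le> depth v" for w
    using depth_adj[OF that(1)] that(2) by simp
  have pos: "0 < ?c ^ depth v" using inv_sqrt3(1) by simp
  have "(\<Sum>w\<in>?A. ?c ^ depth w) \<le> 6 * ?c * ?c ^ depth v"
  proof (cases "\<exists>w\<in>?A. depth w \<le> depth v")
    case True
    then obtain w0 where w0: "adj v w0" "depth w0 \<le> depth v" by auto
    have "(\<Sum>w\<in>?A. ?c ^ depth w) = ?c ^ depth w0 + (\<Sum>w\<in>?A - {w0}. ?c ^ depth w)"
      using fin w0 by (intro sum.remove) auto
    also have "(\<Sum>w\<in>?A - {w0}. ?c ^ depth w) = (\<Sum>w\<in>?A - {w0}. ?c * ?c ^ depth v)"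
      using unique_lower_neighbour[OF w0(1)] w0(2) up by (intro sum.cong) fastforce+
    also have "\<dots> = 3 * ?c * ?c ^ depth v" using fin w0 by simp
    also have "?c ^ depth w0 \<le> 3 * ?c * ?c ^ depth v"
      using wgt_nbr[of "(w0, k)" "(v, k)"] w0 by (simp add: nbr_eq[OF x(2)] wgt_def)
    finally show ?thesis by simp
  next
    case False
    then have "(\<Sum>w\<in>?A. ?c ^ depth w) = (\<Sum>w\<in>?A. ?c * ?c ^ depth v)"
      using up by (intro sum.cong) auto
    also have "\<dots> = 4 * (?c * ?c ^ depth v)" using fin by simp
    also have "\<dots> \<le> 6 * (?c * ?c ^ depth v)" using inv_sqrt3(1) by (intro mult_right_mono) auto
    finally show ?thesis by simp
  qed
  then show ?thesis by (simp add: x(1) sum_nbr[OF x(2)] wgt_def algebra_simps)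
qed

text \<open>Non-backtracking walks with \<open>m\<close> further steps that start at \<open>x\<close> and have come from \<open>u\<close>.\<close>

primrec nb_walks :: "nat \<Rightarrow> 'v \<times> int \<Rightarrow> 'v \<times> int \<Rightarrow> ('v \<times> int) list set" where
  "nb_walks 0 u x = {[x]}"
| "nb_walks (Suc m) u x = (\<Union>y\<in>nbr x - {u}. (#) x ` nb_walks m x y)"

lemma finite_nb_walks [simp]: "finite (nb_walks m u x)"
  by (induction m arbitrary: u x) (auto simp: finite_nbr)

lemma nb_walks_hd: "l \<in> nb_walks m u x \<Longrightarrow> l \<noteq> [] \<and> hd l = x"
  by (cases m) auto

lemma nb_walksI:
  "successively (\<lambda>x y. y \<in> nbr x) (x # xs) \<Longrightarrow> distinct (u # x # xs) \<Longrightarrow>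
    x # xs \<in> nb_walks (length xs) u x"
proof (induction xs arbitrary: u x)
  case (Cons y xs)
  then have "y # xs \<in> nb_walks (length xs) x y" by simp
  then show ?case using Cons.prems by auto
qed simp

text \<open>The function \<open>wgt x - p * wgt u\<close> of a directed edge from \<open>u\<close> to \<open>x\<close> is a strict supersolution for
  the weighted count of non-backtracking walks, because \<open>p * (2 * sqrt 3 + 2 - 5 * p) < 1\<close>
  for \<open>p = 0.2324\<close>.\<close>

lemma nb_walks_bound:
  assumes "x \<in> nbr u"
  shows "59/100 * (2324/10000) ^ m * (\<Sum>l\<in>nb_walks m u x. wgt (last l)) \<le>
    (9999/10000) ^ m * (wgt x - 2324/10000 * wgt u)"
  using assms
proof (induction m arbitrary: u x)
  \<comment> \<open>Weights of neighbours differ by a factor of at most sqrt 3, and 0.2324 * sqrt 3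
    < 0.41; this is where 59/100 comes from.\<close>
  case 0
  have "2324/10000 * wgt u \<le> 2324/10000 * (3 * inv_sqrt3 * wgt x)"
    using wgt_nbr[OF nbr_sym[OF 0]] by (intro mult_left_mono) auto
  also have "\<dots> = (2324/10000 * 3 * inv_sqrt3) * wgt x" by simp
  also have "\<dots> \<le> 41/100 * wgt x"
    using inv_sqrt3(4) wgt_pos[of x] by (intro mult_right_mono) auto
  finally show ?case by simp
next
  case (Suc m)
  let ?p = "2324/10000 :: real" and ?t = "9999/10000 :: real"
  have V: "x \<in> verts TZ" using nbr_verts[OF Suc.prems] by blast
  have u: "u \<in> nbr x" using nbr_sym[OF Suc.prems] .
  have c5: "card (nbr x - {u}) = 5" using card_nbr[OF V] u finite_nbr by simp
  have "(\<Sum>l\<in>nb_walks (Suc m) u x. wgt (last l)) =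
      (\<Sum>y\<in>nbr x - {u}. \<Sum>l\<in>(#) x ` nb_walks m x y. wgt (last l))"
    unfolding nb_walks.simps
  proof (rule sum.UNION_disjoint)
    have "y = y'" if "l \<in> nb_walks m x y" "l \<in> nb_walks m x y'" for l y y'
      using nb_walks_hd[OF that(1)] nb_walks_hd[OF that(2)] by simp
    then show "\<forall>y\<in>nbr x - {u}. \<forall>y'\<in>nbr x - {u}. y \<noteq> y' \<longrightarrow>
        (#) x ` nb_walks m x y \<inter> (#) x ` nb_walks m x y' = {}"
      by blast
  qed (auto simp: finite_nbr)
  also have "\<dots> = (\<Sum>y\<in>nbr x - {u}. \<Sum>l\<in>nb_walks m x y. wgt (last l))"
  proof (rule sum.cong[OF refl])
    fix y
    have "(\<Sum>l\<in>(#) x ` nb_walks m x y. wgt (last l)) = (\<Sum>l\<in>nb_walks m x y. wgt (last (x # l)))"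
      by (subst sum.reindex) auto
    also have "\<dots> = (\<Sum>l\<in>nb_walks m x y. wgt (last l))"
      using nb_walks_hd by (intro sum.cong) (auto simp del: split_paired_All)
    finally show "(\<Sum>l\<in>(#) x ` nb_walks m x y. wgt (last l)) = (\<Sum>l\<in>nb_walks m x y. wgt (last l))" .
  qed
  finally have eq: "(\<Sum>l\<in>nb_walks (Suc m) u x. wgt (last l)) =
      (\<Sum>y\<in>nbr x - {u}. \<Sum>l\<in>nb_walks m x y. wgt (last l))" .
  have "59/100 * ?p ^ Suc m * (\<Sum>l\<in>nb_walks (Suc m) u x. wgt (last l)) =
      ?p * (\<Sum>y\<in>nbr x - {u}. 59/100 * ?p ^ m * (\<Sum>l\<in>nb_walks m x y. wgt (last l)))"
    unfolding eq power_Suc sum_distrib_left by (simp only: mult_ac)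
  also have "\<dots> \<le> ?p * (\<Sum>y\<in>nbr x - {u}. ?t ^ m * (wgt y - ?p * wgt x))"
    using Suc.IH by (intro mult_left_mono sum_mono) auto
  also have "\<dots> = ?t ^ m * (?p * ((\<Sum>y\<in>nbr x - {u}. wgt y) - 5 * (?p * wgt x)))"
    unfolding sum_distrib_left[symmetric] sum_subtractf using c5 by (simp add: mult_ac)
  also have "(\<Sum>y\<in>nbr x - {u}. wgt y) = (\<Sum>y\<in>nbr x. wgt y) - wgt u"
    using u finite_nbr by (simp add: sum_diff1)
  also have "?t ^ m * (?p * ((\<Sum>y\<in>nbr x. wgt y) - wgt u - 5 * (?p * wgt x))) \<le>
      ?t ^ m * (?t * (wgt x - ?p * wgt u))"
  proof (rule mult_left_mono)
    have "?p * ((\<Sum>y\<in>nbr x. wgt y) - wgt u - 5 * (?p * wgt x)) \<le>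
        ?p * ((6 * inv_sqrt3 + 2) * wgt x - wgt u - 5 * (?p * wgt x))"
      using sum_wgt_nbr[OF V] by (intro mult_left_mono) auto
    \<comment> \<open>The forbidden step back to \<open>u\<close> supplies exactly the term
      \<open>- ?p * wgt u\<close> of the supersolution. The coefficient of \<open>wgt x\<close> is
      about 0.9998, just below \<open>?t\<close>.\<close>
    also have "\<dots> = ?p * (6 * inv_sqrt3 + 2 - 5 * ?p) * wgt x - ?p * wgt u"
      by (simp add: algebra_simps)
    also have "?p * (6 * inv_sqrt3 + 2 - 5 * ?p) * wgt x \<le> ?t * wgt x"
      using inv_sqrt3(4) wgt_pos[of x] by (intro mult_right_mono) auto
    also have "?t * wgt x - ?p * wgt u \<le> ?t * (wgt x - ?p * wgt u)"
      using wgt_pos[of u] by simp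
    finally show "?p * ((\<Sum>y\<in>nbr x. wgt y) - wgt u - 5 * (?p * wgt x)) \<le> ?t * (wgt x - ?p * wgt u)"
      by simp
  qed simp
  finally show ?case by (simp only: power_Suc mult_ac)
qed

end

section \<open>Decay of connection probabilities\<close>

lemma sum_UNION_le:
  fixes f :: "'b \<Rightarrow> real"
  assumes "finite I" "\<And>i. i \<in> I \<Longrightarrow> finite (A i)" "\<And>x. 0 \<le> f x"
  shows "sum f (\<Union>i\<in>I. A i) \<le> (\<Sum>i\<in>I. sum f (A i))"
  using assms(1,2)
proof (induction rule: finite_induct)
  case (insert i I)
  have "sum f (\<Union>j\<in>insert i I. A j) =
      sum f (A i) + sum f (\<Union>j\<in>I. A j) - sum f (A i \<inter> (\<Union>j\<in>I. A j))"
    using insert by (simp add: sum_Un)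
  moreover have "0 \<le> sum f (A i \<inter> (\<Union>j\<in>I. A j))" using assms(3) by (simp add: sum_nonneg)
  ultimately show ?case using insert by simp
qed simp

context rooted_tree
begin

lemma path_height:
  "successively (\<lambda>x y. y \<in> nbr x) (x # xs) \<Longrightarrow> \<bar>snd (last (x # xs)) - snd x\<bar> \<le> int (length xs)"
proof (induction xs arbitrary: x)
  case (Cons y xs)
  have "\<bar>snd y - snd x\<bar> \<le> 1"
    using Cons.prems by (cases x; cases y) (auto simp: nbr_def edges_TZ_iff)
  moreover have "\<bar>snd (last (y # xs)) - snd y\<bar> \<le> int (length xs)"
    using Cons by simp
  ultimately show ?case by simp
qed simp

lemma wgt_le_1: "wgt x \<le> 1"
  using inv_sqrt3 by (simp add: wgt_def power_le_one)

text \<open>A union bound over self-avoiding paths, enlarged to non-backtracking walks because these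
  obey a one-step recursion. Distinct vertices make the \<open>Suc m\<close> edges distinct.\<close>

lemma prob_path_le:
  fixes j :: int and x :: "'v \<times> int"
  assumes p: "0 \<le> p" "p \<le> 2324/10000" and rt_k: "x = (rt, k)"
  defines "A \<equiv> \<lambda>m. {\<omega> \<in> space (percolation TZ p). \<exists>xs. distinct (x # xs) \<and> length xs = Suc m \<and>
      last (x # xs) = (rt, j) \<and> successively (open_adj \<omega>) (x # xs)}"
  shows "A m \<in> sets (percolation TZ p)" "measure (percolation TZ p) (A m) \<le> 3 * (9999/10000) ^ m"
proof -
  let ?P = "percolation TZ p"
  interpret prob_space ?P by (rule prob_space_percolation)
  define W where "W = {xs \<in> (\<Union>y\<in>nbr x. nb_walks m x y). distinct (x # xs) \<and> length xs = Suc m \<and>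
      last xs = (rt, j) \<and> successively (\<lambda>x y. y \<in> nbr x) (x # xs)}"
  define B where "B xs = {\<omega> \<in> space ?P. \<forall>e\<in>path_edges (x # xs). \<omega> e}" for xs
  have fin: "finite W" unfolding W_def by (simp add: finite_nbr)
  have sub: "path_edges (x # xs) \<subseteq> edges TZ" if "xs \<in> W" for xs
  proof -
    have "successively (\<lambda>x y. {x, y} \<in> edges TZ) (x # xs)"
      using that unfolding W_def nbr_def mem_Collect_eq by blast
    then show ?thesis using path_edges_iff_successively[of "x # xs" "\<lambda>e. e \<in> edges TZ"] by blast
  qed
  have B_sets: "B xs \<in> sets ?P" if "xs \<in> W" for xs
    unfolding B_def using sets_cylinder[of "path_edges (x # xs)" TZ p "\<lambda>_. True"] sub[OF that] by simp
  have Bprob: "prob (B xs) = p ^ Suc m" if "xs \<in> W" for xs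
    unfolding B_def using p sub[OF that] card_path_edges[of "x # xs"] that
    by (subst prob_all_open) (auto simp: W_def)
  have A_eq: "A m = (\<Union>xs\<in>W. B xs)"
  proof (intro equalityI subsetI)
    fix \<omega> assume "\<omega> \<in> A m"
    then obtain xs where xs: "\<omega> \<in> space ?P" "distinct (x # xs)" "length xs = Suc m"
      "last (x # xs) = (rt, j)" "successively (open_adj \<omega>) (x # xs)" unfolding A_def by blast
    obtain y ys where ys: "xs = y # ys" using xs(3) by (cases xs) auto
    have nb: "successively (\<lambda>x y. y \<in> nbr x) (x # xs)"
      using xs(5) by (rule successively_mono) (auto simp: nbr_def open_adj_def)
    have nb': "y \<in> nbr x" "successively (\<lambda>x y. y \<in> nbr x) (y # ys)" using nb by (simp_all add: ys)
    have len: "length ys = m" using xs(3) by (simp add: ys)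
    have "xs \<in> nb_walks m x y"
      using nb_walksI[OF nb'(2), of x] xs(2) unfolding ys len by blast
    moreover have "last xs = (rt, j)" using xs(4) by (simp add: ys)
    ultimately have "xs \<in> W" using xs(2,3) nb nb'(1) unfolding W_def by blast
    moreover have "\<forall>e\<in>path_edges (x # xs). \<omega> e"
      unfolding path_edges_iff_successively using xs(5) by (rule successively_mono) (auto simp: open_adj_def)
    ultimately show "\<omega> \<in> (\<Union>xs\<in>W. B xs)" using xs(1) by (auto simp: B_def)
  next
    fix \<omega> assume "\<omega> \<in> (\<Union>xs\<in>W. B xs)"
    then obtain xs where xs: "xs \<in> W" "\<omega> \<in> space ?P" "\<forall>e\<in>path_edges (x # xs). \<omega> e"
      by (auto simp: B_def)
    have "successively (open_adj \<omega>) (x # xs)"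
      using path_edges_iff_successively[of "x # xs" "\<lambda>e. e \<in> edges TZ \<and> \<omega> e"] xs(3) sub[OF xs(1)]
      unfolding open_adj_def[abs_def] by blast
    moreover have "last (x # xs) = (rt, j)" "distinct (x # xs)" "length xs = Suc m"
      using xs(1) by (auto simp: W_def)
    ultimately show "\<omega> \<in> A m" using xs(2) unfolding A_def by blast
  qed
  show "A m \<in> sets ?P" unfolding A_eq using fin B_sets by (intro sets.finite_UN) auto
  have "prob (A m) \<le> (\<Sum>xs\<in>W. prob (B xs))"
    unfolding A_eq using fin B_sets by (intro finite_measure_subadditive_finite) auto
  \<comment> \<open>The end point lies above the root and has weight 1, so the weight is inserted at
    no cost; only then is the condition on the end point dropped.\<close>
  also have "\<dots> = (\<Sum>xs\<in>W. p ^ Suc m * wgt (last xs))"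
    by (intro sum.cong) (auto simp: Bprob W_def wgt_def)
  also have "\<dots> \<le> (\<Sum>xs\<in>(\<Union>y\<in>nbr x. nb_walks m x y). p ^ Suc m * wgt (last xs))"
    using p wgt_pos by (intro sum_mono2) (auto simp: finite_nbr W_def less_imp_le)
  also have "\<dots> \<le> (\<Sum>y\<in>nbr x. \<Sum>xs\<in>nb_walks m x y. p ^ Suc m * wgt (last xs))"
    using p wgt_pos by (intro sum_UNION_le) (auto simp: finite_nbr less_imp_le)
  \<comment> \<open>The constant 4/10 exceeds 2324/5900; the six neighbours then give 2.4 \<le>
    3.\<close>
  also have "\<dots> \<le> (\<Sum>y\<in>nbr x. 4/10 * (9999/10000) ^ m)"
  proof (rule sum_mono)
    fix y assume y: "y \<in> nbr x"
    let ?s = "\<Sum>xs\<in>nb_walks m x y. wgt (last xs)"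
    have s: "0 \<le> ?s" using wgt_pos by (intro sum_nonneg) (auto simp: less_imp_le)
    have "(\<Sum>xs\<in>nb_walks m x y. p ^ Suc m * wgt (last xs)) = p ^ Suc m * ?s"
      by (simp add: sum_distrib_left)
    also have "\<dots> \<le> (2324/10000) ^ Suc m * ?s"
      using p s by (intro mult_right_mono power_mono) auto
    also have "\<dots> = 2324/5900 * (59/100 * (2324/10000) ^ m * ?s)" by simp
    also have "\<dots> \<le> 2324/5900 * ((9999/10000) ^ m * (wgt y - 2324/10000 * wgt x))"
      using nb_walks_bound[OF y, of m] by (intro mult_left_mono) auto
    also have "\<dots> \<le> 2324/5900 * ((9999/10000) ^ m * 1)"
      using wgt_le_1[of y] wgt_pos[of x] by (intro mult_left_mono) auto
    also have "\<dots> \<le> 4/10 * (9999/10000) ^ m" by simp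
    finally show "(\<Sum>xs\<in>nb_walks m x y. p ^ Suc m * wgt (last xs)) \<le> 4/10 * (9999/10000) ^ m" .
  qed
  also have "\<dots> \<le> 3 * (9999/10000) ^ m"
    using card_nbr[of x] rt by (simp add: rt_k verts_TZ)
  finally show "prob (A m) \<le> 3 * (9999/10000) ^ m" .
qed

text \<open>A step changes the height by at most one, so only paths with at least
  \<open>Suc d\<close> edges count. The geometric series of ratio 0.9999 turns the factor 3 into
  30000.\<close>

lemma prob_connection_le:
  assumes p: "0 \<le> p" "p \<le> 2324/10000" and kj: "\<bar>j - k\<bar> \<ge> int (Suc d)"
  obtains Z where "Z \<in> sets (percolation TZ p)"
    "{\<omega> \<in> space (percolation TZ p). (open_adj \<omega>)\<^sup>*\<^sup>* (rt, k) (rt, j)} \<subseteq> Z"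
    "measure (percolation TZ p) Z \<le> 30000 * (9999/10000) ^ d"
proof -
  let ?P = "percolation TZ p"
  interpret prob_space ?P by (rule prob_space_percolation)
  define A where "A m = {\<omega> \<in> space (percolation TZ p). \<exists>xs. distinct ((rt, k) # xs) \<and> length xs = Suc m \<and>
      last ((rt, k) # xs) = (rt, j) \<and> successively (open_adj \<omega>) ((rt, k) # xs)}" for m
  note A = prob_path_le[OF p refl, where j = j and k = k, folded A_def]
  define Z where "Z = (\<Union>i. A (i + d))"
  have "Z \<in> sets ?P" unfolding Z_def using A(1) by auto
  moreover have "{\<omega> \<in> space ?P. (open_adj \<omega>)\<^sup>*\<^sup>* (rt, k) (rt, j)} \<subseteq> Z"
  proof safe
    fix \<omega> assume \<omega>: "\<omega> \<in> space ?P" "(open_adj \<omega>)\<^sup>*\<^sup>* (rt, k) (rt, j)"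
    obtain ys where ys: "ys \<noteq> []" "hd ys = (rt, k)" "last ys = (rt, j)" "distinct ys" "successively (open_adj \<omega>) ys"
      using rtranclp_simple_path[OF \<omega>(2)] by blast
    then obtain xs where xs: "ys = (rt, k) # xs" by (cases ys) auto
    have "successively (\<lambda>x y. y \<in> nbr x) ((rt, k) # xs)"
      using ys(5) unfolding xs by (rule successively_mono) (auto simp: nbr_def open_adj_def)
    from path_height[OF this] have "Suc d \<le> length xs" using ys(3) kj by (simp add: xs del: last.simps)
    then obtain i where "length xs = Suc (i + d)" by (metis add.commute add_Suc le_iff_add)
    then have "\<omega> \<in> A (i + d)" using \<omega>(1) ys xs unfolding A_def by blast
    then show "\<omega> \<in> Z" by (auto simp: Z_def)
  qed
  moreover have "prob Z \<le> 30000 * (9999/10000) ^ d"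
  proof -
    have sums: "(\<lambda>i. 3 * (9999/10000) ^ d * (9999/10000 :: real) ^ i) sums (3 * (9999/10000) ^ d * (1 / (1 - 9999/10000)))"
      by (intro sums_mult geometric_sums) simp
    have le: "prob (A (i + d)) \<le> 3 * (9999/10000) ^ d * (9999/10000) ^ i" for i
      using A(2)[of "i + d"] by (simp add: power_add mult_ac)
    have summable: "summable (\<lambda>i. prob (A (i + d)))"
      by (rule summable_comparison_test'[OF sums_summable[OF sums], of 0]) (use le in auto)
    have "prob Z \<le> (\<Sum>i. prob (A (i + d)))"
      unfolding Z_def using A(1) summable by (intro finite_measure_subadditive_countably) auto
    also have "\<dots> \<le> (\<Sum>i. 3 * (9999/10000) ^ d * (9999/10000 :: real) ^ i)"
      using le summable sums_summable[OF sums] by (intro suminf_le) auto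
    also have "\<dots> = 30000 * (9999/10000) ^ d" using sums_unique[OF sums] by simp
    finally show ?thesis .
  qed
  ultimately show ?thesis by (rule that)
qed

end

section \<open>Translation along the line\<close>

context rooted_tree
begin

lemma sets_open_adj: "{\<omega> \<in> space (percolation TZ p). open_adj \<omega> x y} \<in> sets (percolation TZ p)"
proof (cases "{x, y} \<in> edges TZ")
  case True
  then show ?thesis
    using sets_cylinder[of "{{x, y}}" TZ p "\<lambda>_. True"] by (simp add: open_adj_def)
qed (simp add: open_adj_def)

lemma countable_verts_TZ: "countable (verts TZ)"
  by (simp add: verts_TZ countable_verts)

lemma sets_open_reach:
  "{\<omega> \<in> space (percolation TZ p). (open_adj \<omega>)\<^sup>*\<^sup>* x y} \<in> sets (percolation TZ p)"
proof -
  have "{\<omega> \<in> space (percolation TZ p). (open_adj \<omega> ^^ n) x y} \<in> sets (percolation TZ p)" for n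
  proof (induction n arbitrary: y)
    case (Suc n)
    have "(open_adj \<omega> ^^ Suc n) x y \<longleftrightarrow> (\<exists>z\<in>verts TZ. (open_adj \<omega> ^^ n) x z \<and> open_adj \<omega> z y)" for \<omega>
      using open_adj_verts[of \<omega> _ y] unfolding relpowp.simps OO_def by blast
    then show ?case
      using Suc sets_open_adj countable_verts_TZ
      by (simp only:) (intro sets.sets_Collect_countable_Ex' sets.sets_Collect_conj)
  qed simp
  then show ?thesis
    unfolding rtranclp_power by (intro sets.sets_Collect_countable_Ex)
qed

abbreviation inf_cluster :: "real \<Rightarrow> 'v \<times> int \<Rightarrow> (('v \<times> int) set \<Rightarrow> bool) set" where
  "inf_cluster p x \<equiv> {\<omega> \<in> space (percolation TZ p). infinite {y. (open_adj \<omega>)\<^sup>*\<^sup>* x y}}"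

text \<open>An enumeration of the vertices turns infinitude into unboundedness in the natural
  numbers, a condition with countable quantifiers.\<close>

lemma sets_inf_cluster:
  assumes "x \<in> verts TZ"
  shows "inf_cluster p x \<in> sets (percolation TZ p)"
proof -
  let ?f = "to_nat_on (verts TZ)"
  have inj: "inj_on ?f (verts TZ)" by (rule inj_on_to_nat_on[OF countable_verts_TZ])
  have "infinite {y. (open_adj \<omega>)\<^sup>*\<^sup>* x y} \<longleftrightarrow> (\<forall>n. \<exists>y\<in>verts TZ. n < ?f y \<and> (open_adj \<omega>)\<^sup>*\<^sup>* x y)" for \<omega>
  proof -
    let ?C = "{y. (open_adj \<omega>)\<^sup>*\<^sup>* x y}"
    have C: "?C \<subseteq> verts TZ" using open_reach_verts[OF _ assms] by blast
    then have "finite (?f ` ?C) \<longleftrightarrow> finite ?C" using inj by (meson finite_image_iff inj_on_subset)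
    then have "infinite ?C \<longleftrightarrow> (\<forall>n. \<exists>k>n. k \<in> ?f ` ?C)" unfolding infinite_nat_iff_unbounded[symmetric] by blast
    also have "\<dots> \<longleftrightarrow> (\<forall>n. \<exists>y\<in>verts TZ. n < ?f y \<and> (open_adj \<omega>)\<^sup>*\<^sup>* x y)"
      using C by blast
    finally show ?thesis .
  qed
  then show ?thesis
    using sets_open_reach countable_verts_TZ
    by (simp only:) (intro sets.sets_Collect_countable_All sets.sets_Collect_countable_Ex' sets.sets_Collect_conj sets.sets_Collect_const)
qed

definition up :: "'v \<times> int \<Rightarrow> 'v \<times> int" where "up x = (fst x, snd x + 1)"

text \<open>The restriction to \<open>edges TZ\<close> keeps the shifted configuration extensional,
  as the space of the product measure demands.\<close>

definition lift :: "(('v \<times> int) set \<Rightarrow> bool) \<Rightarrow> ('v \<times> int) set \<Rightarrow> bool" where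
  "lift \<omega> = (\<lambda>e\<in>edges TZ. \<omega> (up ` e))"

lemma inj_up: "inj up"
  by (auto simp: up_def inj_def prod_eq_iff)

lemma up_edge: "{up x, up y} \<in> edges TZ \<longleftrightarrow> {x, y} \<in> edges TZ"
  by (cases x; cases y) (auto simp: up_def edges_TZ_iff)

lemma edges_TZ_doubleton: "e \<in> edges TZ \<Longrightarrow> \<exists>x y. e = {x, y}"
  by (auto simp: cart_prod_def)

lemma open_adj_lift: "open_adj (lift \<omega>) x y \<longleftrightarrow> open_adj \<omega> (up x) (up y)"
  using up_edge[of x y] by (auto simp: open_adj_def lift_def)

lemma open_reach_lift: "(open_adj (lift \<omega>))\<^sup>*\<^sup>* x y \<longleftrightarrow> (open_adj \<omega>)\<^sup>*\<^sup>* (up x) (up y)"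
proof
  show "(open_adj (lift \<omega>))\<^sup>*\<^sup>* x y \<Longrightarrow> (open_adj \<omega>)\<^sup>*\<^sup>* (up x) (up y)"
    by (induction rule: rtranclp_induct) (auto simp: open_adj_lift intro: rtranclp.rtrancl_into_rtrancl)
  have "(open_adj (lift \<omega>))\<^sup>*\<^sup>* x y" if "(open_adj \<omega>)\<^sup>*\<^sup>* (up x) z" "z = up y" for z
    using that
  proof (induction arbitrary: y rule: rtranclp_induct)
    case base
    then have "y = x" using injD[OF inj_up] by metis
    then show ?case by simp
  next
    case (step z z')
    define w where "w = (fst z, snd z - 1)"
    have w: "z = up w" by (simp add: w_def up_def)
    show ?case using step.IH[OF w] step.hyps(2) unfolding w step.prems open_adj_lift[symmetric]
      by (rule rtranclp.rtrancl_into_rtrancl)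
  qed
  then show "(open_adj \<omega>)\<^sup>*\<^sup>* (up x) (up y) \<Longrightarrow> (open_adj (lift \<omega>))\<^sup>*\<^sup>* x y" by blast
qed

lemma up_edges: "(`) up \<in> edges TZ \<rightarrow> edges TZ"
proof
  fix e assume "e \<in> edges TZ"
  then obtain x y where "e = {x, y}" "{x, y} \<in> edges TZ" using edges_TZ_doubleton by blast
  then show "up ` e \<in> edges TZ" by (simp add: up_edge)
qed

lemma prob_inf_cluster_up:
  assumes x: "x \<in> verts TZ"
  shows "measure (percolation TZ p) (inf_cluster p (up x)) = measure (percolation TZ p) (inf_cluster p x)"
proof -
  let ?P = "percolation TZ p"
  have distr: "distr ?P ?P lift = ?P"
    unfolding percolation_def lift_def[abs_def]
    using distr_PiM_reindex[of "edges TZ" "\<lambda>_. measure_pmf (bernoulli_pmf p)" "(`) up" "edges TZ"]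
      up_edges inj_up by (auto simp: measure_pmf.prob_space_axioms inj_on_def inj_image_eq_iff)
  have meas: "lift \<in> ?P \<rightarrow>\<^sub>M ?P"
    unfolding lift_def[abs_def] percolation_def
    by (intro measurable_restrict measurable_component_singleton) (use up_edges in auto)
  have inf: "infinite {y. (open_adj (lift \<omega>))\<^sup>*\<^sup>* x y} \<longleftrightarrow> infinite {y. (open_adj \<omega>)\<^sup>*\<^sup>* (up x) y}" for \<omega>
  proof -
    have "{y. (open_adj \<omega>)\<^sup>*\<^sup>* (up x) y} = up ` {y. (open_adj (lift \<omega>))\<^sup>*\<^sup>* x y}"
    proof (intro equalityI subsetI)
      fix z assume z: "z \<in> {y. (open_adj \<omega>)\<^sup>*\<^sup>* (up x) y}"
      have "z = up (fst z, snd z - 1)" by (simp add: up_def)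
      then show "z \<in> up ` {y. (open_adj (lift \<omega>))\<^sup>*\<^sup>* x y}"
        using z open_reach_lift[of \<omega> x "(fst z, snd z - 1)"] by (intro image_eqI) auto
    qed (auto simp: open_reach_lift)
    then show ?thesis using inj_up by (metis finite_image_iff inj_on_subset subset_UNIV)
  qed
  have "lift -` inf_cluster p x \<inter> space ?P = inf_cluster p (up x)"
    using measurable_space[OF meas] by (auto simp: inf)
  then have "measure ?P (inf_cluster p (up x)) = measure (distr ?P ?P lift) (inf_cluster p x)"
    using measure_distr[OF meas sets_inf_cluster[OF x]] by simp
  then show ?thesis unfolding distr .
qed

lemma prob_inf_cluster_height:
  assumes "v \<in> verts T"
  shows "measure (percolation TZ p) (inf_cluster p (v, k + int n)) = measure (percolation TZ p) (inf_cluster p (v, k))"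
proof (induction n)
  case (Suc n)
  have "(v, k + int (Suc n)) = up (v, k + int n)" by (simp add: up_def)
  then show ?case using Suc prob_inf_cluster_up[of "(v, k + int n)" p] assms by (simp add: verts_TZ)
qed simp

end

section \<open>The uniqueness threshold\<close>

context rooted_tree
begin

text \<open>A Bonferroni inequality for \<open>n\<close> events of equal probability at heights
  \<open>Suc d\<close> apart. Uniqueness forces a connection on each pairwise intersection, so these
  are exponentially small in \<open>d\<close>; \<open>n * n\<close> is a crude bound for the number
  of pairs.\<close>

lemma unique_infinite_cluster_bound:
  fixes n d :: nat
  assumes p: "0 \<le> p" "p \<le> 2324/10000"
    and unique: "AE \<omega> in percolation TZ p. \<exists>!C. C \<in> clusters TZ \<omega> \<and> infinite C"
  shows "n * measure (percolation TZ p) (inf_cluster p (rt, 0)) - real n * real n * (30000 * (9999/10000) ^ d) \<le> 1"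
proof -
  let ?P = "percolation TZ p"
  interpret prob_space ?P by (rule prob_space_percolation)
  define E where "E i = inf_cluster p (rt, int (i * Suc d))" for i
  define t :: real where "t = 30000 * (9999/10000) ^ d"
  have vert: "(rt, k) \<in> verts TZ" for k :: int using rt by (simp add: verts_TZ)
  have sets: "E i \<in> events" for i unfolding E_def using vert by (rule sets_inf_cluster)
  have PE: "prob (E i) = prob (inf_cluster p (rt, 0))" for i
    using prob_inf_cluster_height[OF rt, of p 0 "i * Suc d"] unfolding E_def by simp
  have pair: "prob (E i \<inter> E j) \<le> t" if "j < i" for i j
  proof -
    have "1 \<le> i - j" using that by simp
    from mult_le_mono1[OF this, of "Suc d"] have "Suc d \<le> (i - j) * Suc d" by (simp only: mult_1)
    then have far: "int (Suc d) \<le> \<bar>int (j * Suc d) - int (i * Suc d)\<bar>"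
      using that by (simp add: diff_mult_distrib algebra_simps flip: of_nat_mult)
    obtain Z where Z: "Z \<in> events"
      "{\<omega> \<in> space ?P. (open_adj \<omega>)\<^sup>*\<^sup>* (rt, int (i * Suc d)) (rt, int (j * Suc d))} \<subseteq> Z" "prob Z \<le> t"
      using prob_connection_le[OF p far] unfolding t_def by blast
    have "AE \<omega> in ?P. \<omega> \<in> E i \<inter> E j \<longrightarrow> \<omega> \<in> Z"
      using unique
    proof eventually_elim
      case (elim \<omega>)
      show ?case
      proof
        assume \<omega>: "\<omega> \<in> E i \<inter> E j"
        have cl: "{y. (open_adj \<omega>)\<^sup>*\<^sup>* (rt, k) y} \<in> clusters TZ \<omega>" for k
          unfolding clusters_TZ using vert by blast
        have "{y. (open_adj \<omega>)\<^sup>*\<^sup>* (rt, int (i * Suc d)) y} = {y. (open_adj \<omega>)\<^sup>*\<^sup>* (rt, int (j * Suc d)) y}"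
          using \<omega> cl[of "int (i * Suc d)"] cl[of "int (j * Suc d)"] elim unfolding E_def by blast
        then have "(open_adj \<omega>)\<^sup>*\<^sup>* (rt, int (i * Suc d)) (rt, int (j * Suc d))" by blast
        then show "\<omega> \<in> Z" using \<omega> Z(2) unfolding E_def by blast
      qed
    qed
    then have "prob (E i \<inter> E j) \<le> prob Z" using Z(1) by (rule finite_measure_mono_AE)
    then show ?thesis using Z(3) by linarith
  qed
  have "n * prob (inf_cluster p (rt, 0)) - real n * real n * t \<le> prob (\<Union>i<n. E i)"
  proof (induction n)
    case (Suc n)
    let ?U = "\<Union>i<n. E i"
    have U: "?U \<in> events" using sets by (intro sets.finite_UN) auto
    have "prob (E n \<inter> ?U) = prob (\<Union>i<n. E n \<inter> E i)" by (simp only: Int_UN_distrib)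
    also have "\<dots> \<le> (\<Sum>i<n. prob (E n \<inter> E i))"
      using sets by (intro finite_measure_subadditive_finite) auto
    also have "\<dots> \<le> (\<Sum>i<n. t)" using pair by (intro sum_mono) auto
    also have "\<dots> = n * t" by simp
    finally have int: "prob (E n \<inter> ?U) \<le> n * t" .
    have "(\<Union>i<Suc n. E i) = ?U \<union> (E n - ?U)" by (auto simp: lessThan_Suc)
    then have "prob (\<Union>i<Suc n. E i) = prob ?U + prob (E n - ?U)"
      using U sets[of n] by (simp only:) (intro finite_measure_Union; auto)
    also have "prob (E n - ?U) = prob (E n) - prob (E n \<inter> ?U)"
      using U sets[of n] by (intro finite_measure_Diff')
    finally have "prob (\<Union>i<Suc n. E i) \<ge> prob ?U + prob (inf_cluster p (rt, 0)) - n * t"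
      using int PE[of n] by linarith
    moreover have "0 \<le> (n + 1) * t" by (simp add: t_def)
    ultimately show ?case using Suc by (simp add: algebra_simps)
  qed simp
  then show ?thesis using prob_le_1[of "\<Union>i<n. E i"] unfolding t_def by linarith
qed

lemma prob_inf_cluster_zero:
  assumes "0 \<le> p" "p \<le> 2324/10000"
    and "AE \<omega> in percolation TZ p. \<exists>!C. C \<in> clusters TZ \<omega> \<and> infinite C"
  shows "measure (percolation TZ p) (inf_cluster p (rt, 0)) = 0"
proof (rule ccontr)
  let ?eta = "measure (percolation TZ p) (inf_cluster p (rt, 0))"
  assume "?eta \<noteq> 0"
  then have pos: "0 < ?eta" by (simp add: zero_less_measure_iff)
  \<comment> \<open>The number of heights is fixed before their distance \<open>d\<close>, so that
    the error can be pushed below 1 and the total exceeds 1.\<close>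
  obtain n :: nat where n: "2 < n * ?eta" using reals_Archimedean3[OF pos] by blast
  then have "0 < n" by (cases n) auto
  obtain d where d: "(9999/10000 :: real) ^ d < 1 / (30000 * (real n * real n))"
    using real_arch_pow_inv[of "1 / (30000 * (real n * real n))" "9999/10000"] \<open>0 < n\<close> by auto
  have "real n * real n * (30000 * (9999/10000) ^ d) < 1"
    using d \<open>0 < n\<close> by (simp add: field_simps)
  then show False using unique_infinite_cluster_bound[OF assms, of n d] n by linarith
qed

lemma not_AE_unique_infinite_cluster:
  assumes p: "0 \<le> p" "p \<le> 2324/10000"
  shows "\<not> (AE \<omega> in percolation TZ p. \<exists>!C. C \<in> clusters TZ \<omega> \<and> infinite C)"
proof
  let ?P = "percolation TZ p"
  interpret prob_space ?P by (rule prob_space_percolation)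
  assume unique: "AE \<omega> in ?P. \<exists>!C. C \<in> clusters TZ \<omega> \<and> infinite C"
  have zero: "prob (inf_cluster p x) = 0" if "x \<in> verts TZ" for x
  proof -
    obtain v k where x: "x = (v, k)" "v \<in> verts T" using \<open>x \<in> verts TZ\<close> unfolding verts_TZ by (blast elim: SigmaE)
    \<comment> \<open>Moving the root to \<open>v\<close> changes depth and weight but neither the
      graph nor the measure.\<close>
    interpret R: rooted_tree T v by unfold_locales (use tree x in auto)
    have 0: "prob (inf_cluster p (v, 0)) = 0" by (rule R.prob_inf_cluster_zero[OF p unique])
    show ?thesis
    proof (cases "0 \<le> k")
      case True
      then show ?thesis using prob_inf_cluster_height[OF x(2), of p 0 "nat k"] 0 by (simp add: x)
    next
      case False
      then show ?thesis using prob_inf_cluster_height[OF x(2), of p k "nat (- k)"] 0 by (simp add: x)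
    qed
  qed
  have "AE \<omega> in ?P. \<omega> \<notin> inf_cluster p x" if "x \<in> verts TZ" for x
  proof -
    have "inf_cluster p x \<in> null_sets ?P"
      using zero[OF that] sets_inf_cluster[OF that] by (simp add: null_sets_def emeasure_eq_measure)
    then show ?thesis by (rule AE_not_in)
  qed
  then have "AE \<omega> in ?P. \<forall>x\<in>verts TZ. \<omega> \<notin> inf_cluster p x"
    unfolding AE_ball_countable[OF countable_verts_TZ] by blast
  then have "AE \<omega> in ?P. False"
    using unique AE_space
  proof eventually_elim
    case (elim \<omega>)
    then obtain C where "C \<in> clusters TZ \<omega>" "infinite C" by blast
    then show False using elim(1,3) unfolding clusters_TZ by blast
  qed
  then show False by simp
qed

lemma all_open_connected:
  assumes "\<And>e. e \<in> edges TZ \<Longrightarrow> \<omega> e"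
  shows "clusters TZ \<omega> = {verts TZ}"
proof -
  have step: "open_adj \<omega> x y" if "{x, y} \<in> edges TZ" for x y
    using that assms by (simp add: open_adj_def)
  have up: "(open_adj \<omega>)\<^sup>*\<^sup>* (v, k) (v, k + int n)" if "v \<in> verts T" for v k n
  proof (induction n)
    case (Suc n)
    have "open_adj \<omega> (v, k + int n) (v, k + int (Suc n))"
      by (rule step) (use that in \<open>auto simp: edges_TZ_iff\<close>)
    then show ?case using Suc by (rule rtranclp.rtrancl_into_rtrancl[rotated])
  qed simp
  have column: "(open_adj \<omega>)\<^sup>*\<^sup>* (v, 0) (v, k)" if "v \<in> verts T" for v k
  proof (cases "0 \<le> k")
    case True
    then show ?thesis using up[OF that, of 0 "nat k"] by simp
  next
    case False
    then show ?thesis using open_adj_rtranclp_sym[OF up[OF that, of k "nat (- k)"]] by simp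
  qed
  have level: "(open_adj \<omega>)\<^sup>*\<^sup>* (rt, 0) (v, 0)" if "adj\<^sup>*\<^sup>* rt v" for v
    using that
  proof (induction rule: rtranclp_induct)
    case (step u v)
    have "open_adj \<omega> (u, 0) (v, 0)" by (rule \<open>\<And>x y. {x, y} \<in> edges TZ \<Longrightarrow> open_adj \<omega> x y\<close>) (use step.hyps in \<open>auto simp: edges_TZ_iff\<close>)
    then show ?case using step.IH by (rule rtranclp.rtrancl_into_rtrancl[rotated])
  qed simp
  have all: "(open_adj \<omega>)\<^sup>*\<^sup>* (rt, 0) x" if "x \<in> verts TZ" for x
    using level[OF reach_rt] column that by (cases x) (auto simp: verts_TZ intro: rtranclp_trans)
  have "(open_adj \<omega>)\<^sup>*\<^sup>* x y" if "x \<in> verts TZ" "y \<in> verts TZ" for x y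
    using open_adj_rtranclp_sym[OF all[OF that(1)]] all[OF that(2)] by (rule rtranclp_trans)
  then have "{y. (open_adj \<omega>)\<^sup>*\<^sup>* x y} = verts TZ" if "x \<in> verts TZ" for x
    using that open_reach_verts[OF _ that] by blast
  moreover have "(rt, 0) \<in> verts TZ" using rt by (simp add: verts_TZ)
  ultimately show ?thesis unfolding clusters_TZ by blast
qed

lemma infinite_verts_TZ: "infinite (verts TZ)"
proof -
  have "infinite (verts T)" using tree by (simp add: regular_tree_def)
  then show ?thesis using rt by (auto simp: verts_TZ finite_cartesian_product_iff)
qed

text \<open>Makes the set in \<open>p_u\<close> nonempty, without which its infimum would carry no
  information.\<close>

lemma AE_unique_infinite_cluster_1:
  "AE \<omega> in percolation TZ 1. \<exists>!C. C \<in> clusters TZ \<omega> \<and> infinite C"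
proof -
  interpret prob_space "percolation TZ 1" by (rule prob_space_percolation)
  have "edges TZ \<subseteq> (\<lambda>(x, y). {x, y}) ` (verts TZ \<times> verts TZ)"
    unfolding cart_prod_def by auto
  then have "countable (edges TZ)"
    using countable_verts_TZ by (meson countable_SIGMA countable_image countable_subset)
  moreover have "AE \<omega> in percolation TZ 1. \<omega> e" if "e \<in> edges TZ" for e
  proof -
    have "prob {\<omega> \<in> space (percolation TZ 1). \<omega> e} = 1"
      using prob_all_open[of 1 "{e}" TZ] that by simp
    then have "AE \<omega> in percolation TZ 1. \<omega> \<in> {\<omega> \<in> space (percolation TZ 1). \<omega> e}"
      by (rule AE_prob_1)
    then show ?thesis by simp
  qed
  ultimately have "AE \<omega> in percolation TZ 1. \<forall>e\<in>edges TZ. \<omega> e"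
    by (simp add: AE_ball_countable)
  then show ?thesis
  proof eventually_elim
    case (elim \<omega>)
    then have "clusters TZ \<omega> = {verts TZ}" by (intro all_open_connected) auto
    then show ?case using infinite_verts_TZ by auto
  qed
qed

lemma p_u_bound: "0.232 < p_u TZ"
proof -
  have "2324/10000 \<le> p_u TZ"
    unfolding p_u_def
  proof (rule cInf_greatest)
    show "{p \<in> {0..1}. AE \<omega> in percolation TZ p. \<exists>!C. C \<in> clusters TZ \<omega> \<and> infinite C} \<noteq> {}"
      using AE_unique_infinite_cluster_1 by force
    fix p assume "p \<in> {p \<in> {0..1}. AE \<omega> in percolation TZ p. \<exists>!C. C \<in> clusters TZ \<omega> \<and> infinite C}"
    then show "2324/10000 \<le> p" using not_AE_unique_infinite_cluster[of p] by (cases "p \<le> 2324/10000") auto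
  qed
  then show ?thesis by simp
qed

end

theorem mainTheorem3:
  fixes T :: "'v sgraph"
  assumes "regular_tree 4 T"
  shows "p_c (T \<box> int_line) < 0.225 \<and> (0.225 :: real) < 0.232 \<and> 0.232 < p_u (T \<box> int_line)"
  proof -
  have "infinite (verts T)" using assms by (simp add: regular_tree_def)
  then obtain v where "v \<in> verts T" using not_finite_existsD by fastforce
  then interpret rooted_tree T v by unfold_locales (use assms in auto)
  show ?thesis using p_c_bound p_u_bound by simp
qed

end
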